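(* Let $Q$ be a prime power and let $\alpha\in\mathbb{F}_{Q^2}^*$. The polynomial $x^{2Q+3}+\alpha x$ permutes $\mathbb{F}_{Q^2}$ if and only if one of the following holds: (1) $Q\equiv\pm 2\pmod{5}$ and $\alpha^{2Q-2}-3\alpha^{Q-1}+1=0$; (2) $Q=5^n$ (for some positive integer $n$) and either $\alpha^{Q-1}=-1$ or $\alpha^{(Q-1)/2}=-1$; (3) $Q=13$ and $\alpha^{12}-3\alpha^6+1=0$; (4) $Q=5$ and $\alpha^4-\alpha^2+1=0$; or (5) $Q=3$ and either $\alpha=1$ or $\alpha^2=-1$. Moreover, the number of elements $\alpha\in\mathbb{F}_{Q^2}$ having the stated properties is $2Q-2$ in case (1) (when $Q\equiv\pm2\pmod 5$), $3(Q-1)/2$ in case (2) (when $Q=5^n$), and $12$, $4$ and $3$ in cases (3), (4) and (5), respectively.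
   Context: For a prime power $Q$, $\mathbb{F}_Q$ denotes the finite field with $Q$ elements, and $\mathbb{F}_{Q^2}^*$ is the set of nonzero elements of $\mathbb{F}_{Q^2}$. A polynomial $f(x)$ permutes a finite field $\mathbb{F}$ if the function $\alpha\mapsto f(\alpha)$ is a bijection from $\mathbb{F}$ to itself. *)

theory Defs
  imports
    "HOL-Number_Theory.Number_Theory"
    "HOL-Computational_Algebra.Computational_Algebra"
begin

definition permutation_poly :: "'a::finite_field poly \<Rightarrow> bool" where
  "permutation_poly f \<longleftrightarrow> bij (poly f)"

end

theory Submission
  imports Defs
begin

text \<open>
  The polynomial is \<open>f x = x * (n\<^sup>2 + \<alpha>)\<close> with \<open>n = x ^ (q + 1)\<close> the norm of \<open>x\<close>, and
  the norm of \<open>f x\<close> is \<open>g n\<close> for the quintic \<open>g t = t ^ 5 + T * t ^ 3 + N * t\<close> with \<open>T\<close>, \<open>N\<close>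
  the trace and norm of \<open>\<alpha>\<close>. So \<open>f\<close> permutes the big field iff \<open>g\<close> permutes the subfield of
  order \<open>q\<close>. If it does, then by Hermite's criterion certain coefficients of \<open>g ^ k\<close> vanish;
  apart from small \<open>q\<close> and characteristic 5, at most three well-chosen \<open>k\<close> force
  \<open>T\<^sup>2 = 5 * N\<close>, that is, \<open>g\<close> is a Dickson polynomial. In characteristic 5 the collisions
  of \<open>g\<close> are governed by the quadratic character of a quartic polynomial, and comparing a few
  coefficients of its \<open>(q - 1) / 2\<close>-th power leaves \<open>T = 0\<close> or \<open>T\<^sup>2 = 4 * N\<close>.
\<close>

section \<open>Power maps on finite fields and the subfield of order q\<close>

text \<open>The exponents have the form \<open>k = (q + s) / 5\<close> with
  \<open>s = 2 * m - 1\<close>. Once \<open>q > s + 2\<close>, Hermite's sum reduces to the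
  coefficient with index \<open>m\<close>, and \<open>q = 0\<close> in the field lets it be computed
  with \<open>k = s / 5\<close>: one equation in \<open>T\<close> and \<open>N\<close> independent
  of \<open>q\<close>. This fails only if the characteristic divides a denominator or kills a
  leading binomial (primes 2, 3, 7, 11, 17), or if \<open>q\<close> is too small; the case splits
  come from there. For \<open>q\<close> congruent to 3 modulo 5 the first equation has the spurious
  factor \<open>5 * N - 2 * T ^ 2\<close>. It really occurs for \<open>q = 13\<close>; in
  characteristic 17 the coefficients used leave it open, and it is refuted because \<open>T\<close>
  and \<open>N\<close> come from an element \<open>\<alpha>\<close> of the big field. Likewise
  \<open>q = 5\<close> is exceptional because \<open>(q - 1) / 2 = 2\<close> is too small for the
  second coefficient comparison. The polynomial \<open>w ^ 2 - 3 * w + 1\<close> links criterion and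
  counts: it governs the conic behind \<open>T ^ 2 = 5 * N\<close>, has no root in the subfield, and
  its roots have norm 1, hence are \<open>(q - 1)\<close>-th powers.\<close>

lemma card_power_eq_le:
  fixes c :: "'a::idom"
  assumes "d > 0"
  shows "card {x. x ^ d = c} \<le> d"
proof -
  have "monom 1 d - [:c:] \<noteq> 0"
  proof
    assume "monom 1 d - [:c:] = 0"
    then have "coeff (monom 1 d - [:c:]) d = 0" by simp
    with assms show False by (cases d) auto
  qed
  from card_poly_roots_bound[OF this]
  have "card {x. x ^ d = c} \<le> degree (monom 1 d - [:c:])"
    by (simp add: poly_monom)
  also have "\<dots> \<le> d"
    by (rule degree_diff_le) (auto simp: degree_monom_eq)
  finally show ?thesis .
qed

text \<open>The \<open>d\<close>-th power map sends the \<open>d * e\<close> units into the at most \<open>e\<close> roots of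
  \<open>c ^ e = 1\<close>, with fibres of size at most \<open>d\<close>; so both bounds are attained.\<close>

lemma card_power_eq:
  fixes c :: "'a::finite_field"
  assumes "d * e = card (UNIV :: 'a set) - 1" and "c ^ e = 1"
  shows "card {x. x ^ d = c} = d"
proof -
  define R where "R = {c::'a. c ^ e = 1}"
  have gt: "card (UNIV :: 'a set) > 1"
    using card_mono[of UNIV "{0, 1::'a}"] by simp
  then have d: "d > 0" and e: "e > 0"
    using assms(1) by (auto intro: Nat.gr0I)
  have unit: "x ^ (d * e) = 1" if "x \<noteq> 0" for x :: 'a
  proof -
    have "x * x ^ (card (UNIV :: 'a set) - 1) = x"
      using finite_field_power_card_eq_same[of x] gt by (simp flip: power_Suc)
    then show ?thesis using that assms(1) by simp
  qed
  have R: "card R \<le> e"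
    unfolding R_def by (rule card_power_eq_le[OF e])
  have cd: "card {x. x ^ d = y} \<le> d" for y :: 'a
    by (rule card_power_eq_le[OF d])
  have cR: "c \<in> R" using assms(2) by (simp add: R_def)
  have "UNIV - {0} \<subseteq> (\<Union>y\<in>R. {x. x ^ d = y})"
    using unit by (auto simp: R_def power_mult)
  then have "card (UNIV - {0::'a}) \<le> card (\<Union>y\<in>R. {x. x ^ d = y})"
    by (intro card_mono) auto
  also have "\<dots> \<le> (\<Sum>y\<in>R. card {x. x ^ d = y})"
    by (intro card_UN_le) auto
  also have "\<dots> = card {x. x ^ d = c} + (\<Sum>y\<in>R - {c}. card {x. x ^ d = y})"
    using cR by (intro sum.remove) auto
  also have "\<dots> \<le> card {x. x ^ d = c} + card (R - {c}) * d"
    using sum_bounded_above[of "R - {c}" "\<lambda>y. card {x. x ^ d = y}" d] cd by auto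
  also have "card (R - {c}) = card R - 1"
    using cR by (intro card_Diff_singleton) auto
  finally have le: "d * e \<le> card {x. x ^ d = c} + (card R - 1) * d"
    using assms(1) by (simp add: card_Diff_subset)
  have "(card R - 1) * d \<le> (e - 1) * d"
    using R by (intro mult_right_mono) auto
  moreover have "(e - 1) * d + d = d * e"
    using e by (cases e) auto
  ultimately have "d \<le> card {x. x ^ d = c}" using le by linarith
  with cd[of c] show ?thesis by simp
qed

locale quadratic_extension =
  fixes q :: nat and field_type :: "'a::finite_field itself"
  assumes primepow_q: "primepow q" and card_field: "card (UNIV :: 'a set) = q ^ 2"
begin

definition F :: "'a set" where "F = {t. t ^ q = t}"

lemma q_char_power: "\<exists>n>0. q = CHAR('a) ^ n"
proof -
  obtain p n where p: "prime p" "n > 0" "q = p ^ n"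
    using primepow_q unfolding primepow_def by auto
  have "CHAR('a) dvd p ^ (n * 2)"
    using CHAR_dvd_CARD[where ?'a = 'a] p(3) card_field by (simp add: power_mult)
  then have "CHAR('a) dvd p"
    using CHAR_prime prime_dvd_power by blast
  then have "CHAR('a) = p"
    using CHAR_prime p(1) primes_dvd_imp_eq by blast
  with p show ?thesis by blast
qed

lemma q_gt_1: "q > 1"
  using primepow_gt_Suc_0[OF primepow_q] by simp

lemma of_nat_q [simp]: "of_nat q = (0::'a)"
  using q_char_power by auto

lemma frobenius_add: "(x + y) ^ q = x ^ q + y ^ q" for x y :: 'a
  using q_char_power freshmans_dream'[OF CHAR_prime] by blast

lemma frobenius_uminus: "(- x) ^ q = - (x ^ q)" for x :: 'a
  using frobenius_add[of x "- x"] q_gt_1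
  by (simp add: eq_neg_iff_add_eq_0 add.commute power_0_left)

lemma frobenius_diff: "(x - y) ^ q = x ^ q - y ^ q" for x y :: 'a
  using frobenius_add[of x "- y"] by (simp add: frobenius_uminus)

lemma frobenius_frobenius: "(x ^ q) ^ q = x" for x :: 'a
  using finite_field_power_card_eq_same[of x] card_field
  by (simp add: power2_eq_square flip: power_mult)

lemma F_0 [simp]: "0 \<in> F" and F_1 [simp]: "1 \<in> F"
  using q_gt_1 by (simp_all add: F_def)

lemma F_add: "x \<in> F \<Longrightarrow> y \<in> F \<Longrightarrow> x + y \<in> F"
  by (simp add: F_def frobenius_add)

lemma F_diff: "x \<in> F \<Longrightarrow> y \<in> F \<Longrightarrow> x - y \<in> F"
  by (simp add: F_def frobenius_diff)

lemma F_uminus: "x \<in> F \<Longrightarrow> - x \<in> F"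
  by (simp add: F_def frobenius_uminus)

lemma F_mult: "x \<in> F \<Longrightarrow> y \<in> F \<Longrightarrow> x * y \<in> F"
  by (simp add: F_def power_mult_distrib)

lemma F_divide: "x \<in> F \<Longrightarrow> y \<in> F \<Longrightarrow> x / y \<in> F"
  by (simp add: F_def power_divide)

lemma F_power: "x \<in> F \<Longrightarrow> x ^ k \<in> F"
  by (induction k) (auto intro: F_mult)

lemma F_of_nat [simp]: "of_nat k \<in> F"
  by (induction k) (auto intro: F_add)

lemma F_numeral [simp]: "numeral k \<in> F"
  using F_of_nat[of "numeral k"] by simp

lemmas F_intros = F_add F_diff F_uminus F_mult F_divide F_power F_0 F_1 F_of_nat F_numeral

lemma card_field_minus_1: "(q - 1) * (q + 1) = card (UNIV :: 'a set) - 1"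
  using card_field q_gt_1 by (simp add: power2_eq_square diff_mult_distrib)

lemma F_power_q_minus_1: "x ^ (q - 1) = 1" if "x \<in> F" "x \<noteq> 0" for x :: 'a
proof -
  have "x * x ^ (q - 1) = x"
    using that q_gt_1 by (simp add: F_def flip: power_Suc)
  with that show ?thesis by simp
qed

lemma F_iff_power_q_minus_1: "x \<noteq> 0 \<Longrightarrow> x \<in> F \<longleftrightarrow> x ^ (q - 1) = 1" for x :: 'a
  using q_gt_1 power_Suc[of x "q - 1"] by (auto simp: F_def simp del: power_Suc)

lemma unit_power: "x ^ ((q - 1) * (q + 1)) = 1" if "x \<noteq> 0" for x :: 'a
proof -
  have "x * x ^ (card (UNIV :: 'a set) - 1) = x"
    using finite_field_power_card_eq_same[of x] finite_UNIV_card_ge_0[where ?'a = 'a]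
    by (simp flip: power_Suc)
  then show ?thesis using that card_field_minus_1 by simp
qed

lemma card_F: "card F = q"
proof -
  have "x \<in> F \<longleftrightarrow> x = 0 \<or> x ^ (q - 1) = 1" for x
    using F_iff_power_q_minus_1[of x] by (cases "x = 0") simp_all
  then have "F = insert 0 {x. x ^ (q - 1) = 1}" by auto
  moreover have "card {x::'a. x ^ (q - 1) = 1} = q - 1"
    by (rule card_power_eq[OF card_field_minus_1]) simp
  moreover have "0 \<notin> {x::'a. x ^ (q - 1) = 1}"
    using q_gt_1 by (simp add: power_0_left)
  ultimately show ?thesis using q_gt_1 by simp
qed

lemma norm_in_F: "x ^ (q + 1) \<in> F" for x :: 'a
  using frobenius_frobenius[of x] by (simp add: F_def power_mult_distrib mult.commute)

lemma norm_surj: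
  assumes "t \<in> F" "t \<noteq> 0"
  obtains x :: 'a where "x ^ (q + 1) = t"
proof -
  have "card {x. x ^ (q + 1) = t} = q + 1"
    using assms card_field_minus_1 F_power_q_minus_1
    by (intro card_power_eq[where e = "q - 1"]) (auto simp: mult.commute)
  then have "{x. x ^ (q + 1) = t} \<noteq> {}" by fastforce
  then show ?thesis using that by blast
qed

text \<open>If \<open>q - 1\<close> does not divide \<open>m\<close>, some unit \<open>u\<close> of
  \<open>F\<close> has \<open>u ^ m \<noteq> 1\<close>, and scaling by \<open>u\<close> multiplies
  the sum by \<open>u ^ m\<close>. Positivity of \<open>m\<close> matters because of
  \<open>0 ^ 0 = 1\<close>.\<close>

lemma sum_power_F:
  assumes "m > 0"
  shows "(\<Sum>t\<in>F. t ^ m) = (if (q - 1) dvd m then - 1 else 0)"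
proof (cases "(q - 1) dvd m")
  case True
  have "(\<Sum>t\<in>F. t ^ m) = (\<Sum>t\<in>F - {0}. t ^ m)"
    using assms by (intro sum.mono_neutral_right) auto
  also have "\<dots> = (\<Sum>t\<in>F - {0}. 1)"
    using True F_power_q_minus_1 by (intro sum.cong) (auto simp: power_mult elim!: dvdE)
  also have "\<dots> = - 1"
    using card_F q_gt_1 by simp
  finally show ?thesis using True by simp
next
  case False
  define d where "d = m mod (q - 1)"
  have d: "0 < d" "d < q - 1"
    using False q_gt_1 by (auto simp: d_def mod_eq_0_iff_dvd intro: Nat.gr0I)
  have "\<not> F - {0} \<subseteq> {x. x ^ d = 1}"
  proof
    assume "F - {0} \<subseteq> {x. x ^ d = 1}"
    then have "card (F - {0}) \<le> card {x::'a. x ^ d = 1}" by (intro card_mono) auto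
    also have "\<dots> \<le> d" by (rule card_power_eq_le[OF d(1)])
    finally show False using card_F d(2) by simp
  qed
  then obtain u where u: "u \<in> F" "u \<noteq> 0" "u ^ d \<noteq> 1" by blast
  have "u ^ m = u ^ ((q - 1) * (m div (q - 1)) + d)"
    by (simp add: d_def)
  also have "\<dots> = u ^ d"
    using F_power_q_minus_1[OF u(1,2)] by (simp add: power_add power_mult)
  finally have um: "u ^ m \<noteq> 1" using u by simp
  have "(\<Sum>t\<in>F. t ^ m) = (\<Sum>t\<in>F. (u * t) ^ m)"
    using u by (intro sum.reindex_bij_witness[of _ "\<lambda>t. u * t" "\<lambda>t. t / u"]) (auto intro: F_intros)
  also have "\<dots> = u ^ m * (\<Sum>t\<in>F. t ^ m)"
    by (simp add: power_mult_distrib sum_distrib_left)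
  finally have "(1 - u ^ m) * (\<Sum>t\<in>F. t ^ m) = 0" by (simp add: algebra_simps)
  with um False show ?thesis by simp
qed

end

section \<open>Hermite's criterion\<close>

text \<open>The coefficient of \<open>t ^ (5 * k - 2 * m)\<close> in \<open>(t ^ 5 + T * t ^ 3 + N * t) ^ k\<close>.\<close>

definition trinomial_coeff :: "'a::comm_ring_1 \<Rightarrow> 'a \<Rightarrow> nat \<Rightarrow> nat \<Rightarrow> 'a" where
  "trinomial_coeff T N k m = coeff ([:1, T, N:] ^ k) m"

text \<open>Write the trinomial as \<open>1 + x * (T + N * x)\<close> and apply the binomial theorem
  twice. Cutting the sum at \<open>m\<close> instead of \<open>k\<close> allows evaluation for a
  numeral \<open>m\<close> and a symbolic \<open>k\<close>.\<close>

lemma trinomial_coeff_eq_sum: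
  "trinomial_coeff T N k m =
    (\<Sum>j\<le>m. of_nat ((k choose j) * (j choose (m - j))) * (T ^ (2 * j - m) * N ^ (m - j)))"
proof -
  have pow: "coeff ([:T, N:] ^ j) i = of_nat (j choose i) * (T ^ (j - i) * N ^ i)" for j i
  proof (induction j arbitrary: i)
    case (Suc j)
    show ?case
    proof (cases i)
      case (Suc i')
      show ?thesis
      proof (cases "i' < j")
        case True
        then have "j - i' = Suc (j - Suc i')" by simp
        then show ?thesis using Suc
          by (simp add: Suc.IH algebra_simps)
      qed (use Suc in \<open>simp add: Suc.IH binomial_eq_0\<close>)
    qed (simp add: Suc.IH algebra_simps)
  qed (simp add: coeff_1 binomial_eq_0)
  have "[:1, T, N:] = 1 + monom 1 1 * [:T, N:]"
    by (simp add: monom_Suc one_pCons)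
  then have "[:1, T, N:] ^ k = (\<Sum>j\<le>k. of_nat (k choose j) * (monom 1 1 * [:T, N:]) ^ j)"
    using binomial_ring[of "monom 1 1 * [:T, N:]" 1 k] by (simp add: add.commute)
  also have "\<dots> = (\<Sum>j\<le>k. monom (of_nat (k choose j)) j * [:T, N:] ^ j)"
    by (intro sum.cong refl)
      (simp only: power_mult_distrib monom_power power_one mult_1 of_nat_monom mult_monom
        add_0 mult_1_right flip: mult.assoc)
  finally have "trinomial_coeff T N k m =
      (\<Sum>j\<le>k. coeff (monom (of_nat (k choose j)) j * [:T, N:] ^ j) m)"
    by (simp add: trinomial_coeff_def coeff_sum)
  also have "\<dots> = (\<Sum>j\<le>k. if j \<le> m then
      of_nat ((k choose j) * (j choose (m - j))) * (T ^ (2 * j - m) * N ^ (m - j)) else 0)"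
    by (intro sum.cong refl) (auto simp: coeff_monom_mult pow mult.assoc mult_2)
  also have "\<dots> = (\<Sum>j\<in>{..k} \<inter> {..m}.
      of_nat ((k choose j) * (j choose (m - j))) * (T ^ (2 * j - m) * N ^ (m - j)))"
    by (rule sum.mono_neutral_cong_right) (auto split: if_splits)
  also have "\<dots> = (\<Sum>j\<le>m.
      of_nat ((k choose j) * (j choose (m - j))) * (T ^ (2 * j - m) * N ^ (m - j)))"
    by (intro sum.mono_neutral_left ballI) (auto simp: binomial_eq_0)
  finally show ?thesis .
qed

lemma trinomial_coeff_T_0:
  "trinomial_coeff 0 N k (2 * c) = of_nat (k choose c) * N ^ c"
proof -
  have "trinomial_coeff 0 N k (2 * c) = (\<Sum>j\<in>{c}. of_nat ((k choose j) * (j choose (2 * c - j))) *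
      (0 ^ (2 * j - 2 * c) * N ^ (2 * c - j)))"
    unfolding trinomial_coeff_eq_sum
    by (rule sum.mono_neutral_right) (auto simp: power_0_left binomial_eq_0)
  then show ?thesis by simp
qed

lemma trinomial_coeff_T_0_odd:
  assumes "odd m"
  shows "trinomial_coeff 0 N k m = 0"
  unfolding trinomial_coeff_eq_sum
proof (intro sum.neutral ballI)
  fix j
  have "m \<noteq> 2 * j" using assms by auto
  then have "j < m - j \<or> 0 < 2 * j - m" by linarith
  then show "of_nat ((k choose j) * (j choose (m - j))) * (0 ^ (2 * j - m) * N ^ (m - j)) = 0"
    by (auto simp: power_0_left binomial_eq_0)
qed

text \<open>By Frobenius, \<open>[:1, T, N:] ^ r\<close> is 1 plus terms of degree at least
  \<open>r\<close>, so multiplying by it leaves the coefficients below \<open>r\<close>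
  alone.\<close>

lemma trinomial_coeff_add_char_power:
  fixes T N :: "'a::idom"
  assumes "prime CHAR('a)" and "r = CHAR('a) ^ e" and "m < r"
  shows "trinomial_coeff T N (k + r) m = trinomial_coeff T N k m"
proof -
  have "(1 + [:0, 1:] * [:T, N:]) ^ r = 1 ^ r + ([:0, 1:] * [:T, N:]) ^ r"
    using assms by (intro freshmans_dream') simp_all
  moreover have "1 + [:0, 1:] * [:T, N:] = [:1, T, N:]"
    by (simp add: one_pCons)
  ultimately have "[:1, T, N:] ^ r = 1 + ([:0, 1:] * [:T, N:]) ^ r"
    by (simp only: power_one)
  also have "([:0, 1:] * [:T, N:]) ^ r = monom 1 r * [:T, N:] ^ r"
    using monom_power[of "1::'a" 1 r]
    by (simp only: power_mult_distrib) (simp add: monom_Suc one_pCons)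
  finally have "[:1, T, N:] ^ (k + r) = [:1, T, N:] ^ k + monom 1 r * ([:T, N:] ^ r * [:1, T, N:] ^ k)"
    by (simp add: power_add algebra_simps)
  then show ?thesis
    using assms(3) by (simp add: trinomial_coeff_def coeff_monom_mult)
qed

lemma trinomial_coeff_mod_char_power:
  fixes T N :: "'a::idom"
  assumes "prime CHAR('a)" and "r = CHAR('a) ^ e" and "m < r"
  shows "trinomial_coeff T N k m = trinomial_coeff T N (k mod r) m"
proof -
  have "trinomial_coeff T N (k' + i * r) m = trinomial_coeff T N k' m" for k' i
  proof (induction i)
    case (Suc i)
    then show ?case
      using trinomial_coeff_add_char_power[OF assms, of T N "k' + i * r"]
      by (simp add: add.assoc add.commute[of r])
  qed simp
  from this[of "k mod r" "k div r"] show ?thesis by simp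
qed

lemma trinomial_power_expand:
  fixes T N x :: "'a::comm_ring_1"
  shows "(1 + T * x + N * x ^ 2) ^ k = (\<Sum>m\<le>2 * k. trinomial_coeff T N k m * x ^ m)"
proof -
  have "degree ([:1, T, N:] ^ k) \<le> 2 * k"
    using degree_power_le[of "[:1, T, N:]" k] by (rule order_trans) auto
  then have "poly ([:1, T, N:] ^ k) x = (\<Sum>m\<le>2 * k. trinomial_coeff T N k m * x ^ m)"
    unfolding trinomial_coeff_def poly_altdef
    by (intro sum.mono_neutral_left) (auto simp: coeff_eq_0)
  moreover have "poly [:1, T, N:] x = 1 + T * x + N * x ^ 2"
    by (simp add: power2_eq_square algebra_simps)
  ultimately show ?thesis by (simp only: poly_power)
qed

text \<open>Substitute \<open>x = 1 / t ^ 2\<close> in the expansion of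
  \<open>1 + T * x + N * x ^ 2\<close> and multiply by \<open>t ^ (5 * k)\<close>.\<close>

lemma quintic_power_expand:
  fixes T N t :: "'a::field"
  assumes "k > 0"
  shows "(t ^ 5 + T * t ^ 3 + N * t) ^ k =
    (\<Sum>m\<le>2 * k. trinomial_coeff T N k m * t ^ (5 * k - 2 * m))"
proof (cases "t = 0")
  case True
  then show ?thesis using assms by (auto simp: power_0_left intro!: sum.neutral[symmetric])
next
  case False
  have "(1 + T * (1 / t\<^sup>2) + N * (1 / t\<^sup>2) ^ 2) ^ k =
      (\<Sum>m\<le>2 * k. trinomial_coeff T N k m * (1 / t\<^sup>2) ^ m)"
    by (rule trinomial_power_expand)
  then have "t ^ (5 * k) * (1 + T * (1 / t\<^sup>2) + N * (1 / t\<^sup>2) ^ 2) ^ k =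
      (\<Sum>m\<le>2 * k. trinomial_coeff T N k m * (t ^ (5 * k) * (1 / t\<^sup>2) ^ m))"
    by (simp add: sum_distrib_left mult_ac)
  also have "t ^ (5 * k) * (1 + T * (1 / t\<^sup>2) + N * (1 / t\<^sup>2) ^ 2) ^ k =
      (t ^ 5 + T * t ^ 3 + N * t) ^ k"
  proof -
    have "t ^ 5 * (1 + T * (1 / t\<^sup>2) + N * (1 / t\<^sup>2) ^ 2) = t ^ 5 + T * t ^ 3 + N * t"
      using False by (simp add: field_simps eval_nat_numeral)
    then show ?thesis by (simp only: power_mult flip: power_mult_distrib)
  qed
  also have "(\<Sum>m\<le>2 * k. trinomial_coeff T N k m * (t ^ (5 * k) * (1 / t\<^sup>2) ^ m)) =
      (\<Sum>m\<le>2 * k. trinomial_coeff T N k m * t ^ (5 * k - 2 * m))"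
    using False
    by (intro sum.cong refl) (simp add: power_diff power_mult power_divide)
  finally show ?thesis .
qed

lemma coeff_power_char:
  fixes X :: "'a::idom poly"
  assumes "prime CHAR('a)" and "\<not> CHAR('a) dvd j"
  shows "coeff (X ^ CHAR('a)) j = 0"
proof -
  have "X ^ CHAR('a) = (\<Sum>i\<le>degree X. monom (coeff X i) i) ^ CHAR('a)"
    by (simp add: poly_as_sum_of_monoms)
  also have "\<dots> = (\<Sum>i\<le>degree X. monom (coeff X i) i ^ CHAR('a))"
    using assms(1) by (intro freshmans_dream_sum) simp_all
  finally show ?thesis
    using assms(2) by (auto simp: coeff_sum monom_power intro!: sum.neutral)
qed

context quadratic_extension
begin

text \<open>A permutation of \<open>F\<close> preserves power sums, and \<open>t ^ k\<close> sums to
  0 for \<open>0 < k < q - 1\<close>. In the expanded \<open>k\<close>-th power of the quintic,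
  exactly the exponents divisible by \<open>q - 1\<close> contribute.\<close>

theorem hermite_criterion:
  assumes "T \<in> F" "N \<in> F" and inj: "inj_on (\<lambda>t. t ^ 5 + T * t ^ 3 + N * t) F"
    and k: "0 < k" "k < q - 1"
  shows "(\<Sum>m | m \<le> 2 * k \<and> (q - 1) dvd (5 * k - 2 * m). trinomial_coeff T N k m) = 0"
proof -
  let ?g = "\<lambda>t. t ^ 5 + T * t ^ 3 + N * t"
  have "?g ` F \<subseteq> F" using assms(1,2) by (auto intro!: F_intros)
  with inj have "bij_betw ?g F F"
    by (simp add: bij_betw_def endo_inj_surj)
  then have "(\<Sum>t\<in>F. ?g t ^ k) = (\<Sum>t\<in>F. t ^ k)"
    by (rule sum.reindex_bij_betw)
  also have "\<dots> = 0"
    using k by (subst sum_power_F) (auto dest: dvd_imp_le)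
  also have "(\<Sum>t\<in>F. ?g t ^ k) =
      (\<Sum>m\<le>2 * k. trinomial_coeff T N k m * (\<Sum>t\<in>F. t ^ (5 * k - 2 * m)))"
    by (simp add: quintic_power_expand[OF k(1)] sum_distrib_left) (rule sum.swap)
  \<comment> \<open>The exponent is at least \<open>k\<close>, hence positive, as
    \<open>sum_power_F\<close> demands.\<close>
  also have "\<dots> = (\<Sum>m\<le>2 * k. if (q - 1) dvd (5 * k - 2 * m) then - trinomial_coeff T N k m else 0)"
    by (intro sum.cong refl) (use k in \<open>simp add: sum_power_F\<close>)
  also have "\<dots> = (\<Sum>m | m \<le> 2 * k \<and> (q - 1) dvd (5 * k - 2 * m). - trinomial_coeff T N k m)"
    by (rule sum.mono_neutral_cong_right) (auto split: if_splits)
  finally show ?thesis by (simp add: sum_negf)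
qed

text \<open>The exponents are positive and below \<open>2 * (q - 1)\<close>, so \<open>q - 1\<close>
  is the only multiple available. For \<open>5 * k = q + s\<close> this isolates
  \<open>m = (s + 1) / 2\<close>, and the bound on \<open>5 * k\<close> reads
  \<open>q > s + 2\<close>.\<close>

corollary hermite_single:
  assumes "T \<in> F" "N \<in> F" "inj_on (\<lambda>t. t ^ 5 + T * t ^ 3 + N * t) F"
    and "0 < k" "k < q - 1" "5 * k < 2 * (q - 1)" and m: "5 * k = (q - 1) + 2 * m"
  shows "trinomial_coeff T N k m = 0"
proof -
  have "m' = m" if m': "m' \<le> 2 * k" "(q - 1) dvd (5 * k - 2 * m')" for m'
  proof -
    from m'(2) obtain i where i: "5 * k - 2 * m' = (q - 1) * i" by (elim dvdE)
    then have "i > 0" using m'(1) \<open>0 < k\<close> by (intro Nat.gr0I) auto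
    moreover have "(q - 1) * i < (q - 1) * 2" using i assms(6) by linarith
    then have "i < 2" by simp
    ultimately have "i = 1" by simp
    with i m m'(1) show ?thesis by simp
  qed
  moreover have "m \<le> 2 * k" using m assms(6) by linarith
  ultimately have "{m. m \<le> 2 * k \<and> (q - 1) dvd (5 * k - 2 * m)} = {m}"
    using m by auto
  with hermite_criterion[OF assms(1-5)] show ?thesis by simp
qed

section \<open>Reduction to a quintic over the subfield\<close>

lemma poly_eq_norm: "poly (monom 1 (2 * q + 3) + monom \<alpha> 1) x = x * ((x ^ (q + 1))\<^sup>2 + \<alpha>)"
  for x \<alpha> :: 'a
proof -
  have "x ^ (2 * q + 3) = x * (x ^ (q + 1))\<^sup>2"
    by (simp add: eval_nat_numeral mult_2 power_add mult_ac)
  then show ?thesis by (simp add: poly_monom algebra_simps)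
qed

lemma norm_poly:
  fixes x \<alpha> :: 'a
  defines "n \<equiv> x ^ (q + 1)"
  shows "(x * (n\<^sup>2 + \<alpha>)) ^ (q + 1) = n ^ 5 + (\<alpha> + \<alpha> ^ q) * n ^ 3 + \<alpha> ^ (q + 1) * n"
proof -
  have "n ^ q = n" using norm_in_F[of x] by (simp add: n_def F_def)
  then have "(n\<^sup>2) ^ q = n\<^sup>2" by (metis power_mult mult.commute)
  then have *: "(n\<^sup>2 + \<alpha>) ^ q = n\<^sup>2 + \<alpha> ^ q"
    by (simp add: frobenius_add)
  have "(x * (n\<^sup>2 + \<alpha>)) ^ (q + 1) = n * ((n\<^sup>2 + \<alpha>) ^ q * (n\<^sup>2 + \<alpha>))"
    unfolding power_mult_distrib by (simp add: n_def)
  also have "\<dots> = n ^ 5 + (\<alpha> + \<alpha> ^ q) * n ^ 3 + \<alpha> ^ (q + 1) * n"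
    unfolding * by (simp add: eval_nat_numeral algebra_simps)
  finally show ?thesis .
qed

text \<open>If the quintic is injective, \<open>f x = f y\<close> forces equal norms, hence equal
  factors \<open>n ^ 2 + \<alpha>\<close>, and these cancel; a vanishing factor would make
  \<open>n\<close> a zero of the quintic, so \<open>n = 0\<close>. The converse lifts a collision
  along the surjective norm.\<close>

theorem permutation_poly_iff:
  fixes \<alpha> :: 'a
  assumes "\<alpha> \<noteq> 0"
  shows "permutation_poly (monom 1 (2 * q + 3) + monom \<alpha> 1) \<longleftrightarrow>
    inj_on (\<lambda>t. t ^ 5 + (\<alpha> + \<alpha> ^ q) * t ^ 3 + \<alpha> ^ (q + 1) * t) F"
    (is "permutation_poly ?f \<longleftrightarrow> inj_on ?g F")
proof -
  let ?n = "\<lambda>x::'a. x ^ (q + 1)"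
  have f: "poly ?f x = x * ((?n x)\<^sup>2 + \<alpha>)" for x by (rule poly_eq_norm)
  have nf: "?n (poly ?f x) = ?g (?n x)" for x
    unfolding f by (rule norm_poly)
  have f0: "poly ?f 0 = 0" by (simp only: f mult_zero_left)
  have n0: "?n x = 0 \<longleftrightarrow> x = 0" for x by auto
  have "permutation_poly ?f \<longleftrightarrow> inj (poly ?f)"
    unfolding permutation_poly_def bij_def using finite_UNIV_inj_surj[OF finite] by blast
  also have "\<dots> \<longleftrightarrow> inj_on ?g F"
  proof
    assume inj: "inj_on ?g F"
    show "inj (poly ?f)"
    proof (rule injI)
      fix x y assume eq: "poly ?f x = poly ?f y"
      then have "?g (?n x) = ?g (?n y)" by (metis nf)
      then have nxy: "?n x = ?n y" by (rule inj_onD[OF inj _ norm_in_F norm_in_F])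
      show "x = y"
      proof (cases "(?n x)\<^sup>2 + \<alpha> = 0")
        case True
        then have "poly ?f x = 0" by (simp only: f mult_zero_right)
        then have "?g (?n x) = 0" using nf[of x] n0 by metis
        also have "\<dots> = ?g 0" by simp
        finally have "?g (?n x) = ?g 0" .
        then have "?n x = 0" by (rule inj_onD[OF inj _ norm_in_F F_0])
        with nxy show ?thesis by (metis n0)
      next
        case False
        with eq nxy show ?thesis by (simp only: f mult_cancel_right simp_thms)
      qed
    qed
  next
    assume inj: "inj (poly ?f)"
    show "inj_on ?g F"
    proof (rule inj_onI)
      fix s t assume s: "s \<in> F" and t: "t \<in> F" and eq: "?g s = ?g t"
      obtain x where x: "?n x = s"
        using norm_surj[OF s] n0 by blast
      obtain y where y: "?n y = t"
        using norm_surj[OF t] n0 by blast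
      have nn: "?n (poly ?f x) = ?n (poly ?f y)"
        using nf[of x] nf[of y] eq by (simp only: x y)
      show "s = t"
      proof (cases "poly ?f x = 0")
        case True
        then have "poly ?f y = 0" using nn n0 by metis
        with True inj f0 have "x = 0" "y = 0" by (metis injD)+
        with x y show ?thesis by simp
      next
        case False
        \<comment> \<open>For \<open>u\<close> of norm 1, \<open>f (u * x) = u * f x\<close>; so
          \<open>u * x\<close> is a preimage of \<open>f y\<close> with the same norm as
          \<open>x\<close>.\<close>
        define u where "u = poly ?f y / poly ?f x"
        have "?n u = 1"
          using nn False n0[of "poly ?f x"] by (simp add: u_def power_divide del: power_Suc)
        then have "poly ?f (u * x) = u * poly ?f x"
          by (simp only: f power_mult_distrib mult_1_left) (simp add: mult.assoc)
        also have "\<dots> = poly ?f y" using False by (simp add: u_def)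
        finally have "y = u * x" using inj by (metis injD)
        then have "?n y = ?n x"
          using \<open>?n u = 1\<close> by (simp only: power_mult_distrib mult_1_left)
        with x y show ?thesis by simp
      qed
    qed
  qed
  finally show ?thesis .
qed

section \<open>Sufficiency of \<open>T ^ 2 = 5 * N\<close>\<close>

text \<open>The discriminant 5 is a non-square in \<open>F\<close>: \<open>q\<close> is an odd power
  of a prime \<open>p\<close> congruent to 2 or 3 modulo 5, and for odd \<open>p\<close> reciprocity
  makes 5 a non-residue modulo \<open>p\<close>. For \<open>p = 2\<close> the roots are primitive
  cube roots of unity, outside \<open>F\<close> since \<open>q mod 3 = 2\<close>.\<close>

lemma no_root_in_F:
  fixes w :: 'a
  assumes q5: "q mod 5 = 2 \<or> q mod 5 = 3" and "w \<in> F"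
  shows "w\<^sup>2 - 3 * w + 1 \<noteq> 0"
proof
  assume root: "w\<^sup>2 - 3 * w + 1 = 0"
  define p where "p = CHAR('a)"
  have p: "prime p" by (simp add: p_def)
  obtain n where n: "q = p ^ n" "n > 0" using q_char_power unfolding p_def by auto
  have odd_n: "odd n"
  proof
    assume "even n"
    then have "q = (p ^ (n div 2))\<^sup>2" by (simp add: n flip: power_mult)
    moreover have "x\<^sup>2 mod 5 \<noteq> 2" "x\<^sup>2 mod 5 \<noteq> 3" for x :: nat
    proof -
      have "x\<^sup>2 mod 5 = (x mod 5)\<^sup>2 mod 5" by (simp add: power_mod)
      moreover have "x mod 5 \<in> {0, 1, 2, 3, 4}" by auto
      ultimately show "x\<^sup>2 mod 5 \<noteq> 2" "x\<^sup>2 mod 5 \<noteq> 3" by auto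
    qed
    ultimately show False using q5 by metis
  qed
  have w_pow: "w ^ q = w" using assms by (simp add: F_def)
  show False
  proof (cases "p = 2")
    case True
    then have two: "(2::'a) = 0" using of_nat_CHAR[where ?'a = 'a] by (simp add: p_def)
    have "w ^ 3 - 1 = (w - 1) * (w\<^sup>2 - 3 * w + 1) + 2 * (2 * w\<^sup>2 - 2 * w)"
      by (simp add: eval_nat_numeral algebra_simps)
    then have w3: "w ^ 3 = 1" using root two by simp
    then have "w \<noteq> 0" by (auto simp: power_0_left)
    obtain i where "n = 2 * i + 1" using odd_n by (elim oddE)
    then have "q = 4 ^ i * 2" using n True by (simp add: power_mult)
    moreover have "(4::nat) ^ i mod 3 = 1" using power_mod[of "4::nat" 3 i] by simp
    ultimately have "q mod 3 = 2" using mod_mult_left_eq[of "4 ^ i" "3::nat" 2] by simp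
    then have "w ^ q = (w ^ 3) ^ (q div 3) * w\<^sup>2"
      by (metis div_mult_mod_eq mult.commute power_add power_mult)
    then have "w\<^sup>2 = w" using w3 w_pow by simp
    then have "w = 1" using \<open>w \<noteq> 0\<close> by (simp add: power2_eq_square)
    then show False using root two by simp
  next
    case False
    then have p2: "p > 2" using prime_ge_2_nat[OF p] by simp
    then have oddp: "odd p" using p prime_odd_nat by auto
    have p5: "p mod 5 = 2 \<or> p mod 5 = 3"
    proof (rule ccontr)
      assume "\<not> ?thesis"
      then have p014: "p mod 5 \<in> {0, 1, 4}" by auto
      have "p ^ m mod 5 \<in> {0, 1, 4}" for m
      proof (induction m)
        case (Suc m)
        have "p ^ Suc m mod 5 = (p mod 5) * (p ^ m mod 5) mod 5" by (simp add: mod_mult_eq)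
        with Suc p014 show ?case by auto
      qed simp
      from this[of n] show False using q5 n by auto
    qed
    have "\<not> QuadRes 5 (int p)"
    proof
      assume "QuadRes 5 (int p)"
      then obtain y where y: "[y\<^sup>2 = int p] (mod 5)" by (auto simp: QuadRes_def)
      have "y\<^sup>2 mod 5 = (y mod 5)\<^sup>2 mod 5" by (simp add: power_mod)
      moreover have "y mod 5 \<in> {0, 1, 2, 3, 4}" by auto
      ultimately have "y\<^sup>2 mod 5 \<in> {0, 1, 4}" by auto
      moreover have "int p mod 5 = 2 \<or> int p mod 5 = 3" using p5 by presburger
      ultimately show False using y by (auto simp: cong_def)
    qed
    moreover have "\<not> [int p = 0] (mod 5)" using p5 by (auto simp: cong_def) presburger+
    ultimately have "Legendre (int p) (int 5) = - 1" by (simp add: Legendre_def)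
    moreover have "Legendre (int p) (int 5) * Legendre (int 5) (int p)
        = (-1::int) ^ ((p - 1) div 2 * ((5 - 1) div 2))"
      using p p2 p5 by (intro Quadratic_Reciprocity) auto
    moreover have "(- 1 :: int) ^ ((p - 1) div 2 * ((5 - 1) div 2)) = 1"
      by (simp add: minus_one_power_iff)
    ultimately have "Legendre 5 (int p) = - 1" by simp
    then have "[- 1 = 5 ^ ((p - 1) div 2)] (mod int p)"
      using euler_criterion[of p 5] p p2 by simp
    then have "of_int (- 1) = (of_int (5 ^ ((p - 1) div 2)) :: 'a)"
      unfolding p_def by (subst of_int_eq_iff_cong_CHAR)
    then have five: "(5::'a) ^ ((p - 1) div 2) = - 1" by simp
    \<comment> \<open>A square root of the discriminant; the \<open>p\<close>-th power map negates
      it, so the odd exponent \<open>n\<close> gives \<open>r ^ q = - r\<close>.\<close>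
    define r where "r = 2 * w - 3"
    have "r\<^sup>2 = 4 * (w\<^sup>2 - 3 * w + 1) + 5"
      by (simp add: r_def power2_eq_square algebra_simps)
    then have r2: "r\<^sup>2 = 5" using root by simp
    have "p = 2 * ((p - 1) div 2) + 1" using oddp p2 by simp
    then have "r ^ p = (r\<^sup>2) ^ ((p - 1) div 2) * r"
      by (metis power_add power_mult power_one_right)
    then have rp: "r ^ p = - r" using r2 five by simp
    have "r ^ (p ^ m) = (- 1) ^ m * r" for m
    proof (induction m)
      case (Suc m)
      have "r ^ (p ^ Suc m) = (r ^ (p ^ m)) ^ p" by (simp add: mult.commute flip: power_mult)
      also have "\<dots> = (- 1) ^ (m * p) * r ^ p" by (simp add: Suc power_mult_distrib power_mult)
      also have "(- 1 :: 'a) ^ (m * p) = (- 1) ^ m" using oddp by (simp add: minus_one_power_iff)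
      finally show ?case using rp by simp
    qed simp
    from this[of n] have "r ^ q = - r" using odd_n n by simp
    moreover have "r ^ q = r" using F_diff[OF F_mult[OF F_numeral assms(2)] F_numeral]
      by (simp add: F_def r_def)
    ultimately have "2 * r = 0" by simp
    moreover have "\<not> p dvd 2" using p2 by (auto dest: dvd_imp_le)
    then have "(2::'a) \<noteq> 0" using of_nat_eq_0_iff_char_dvd[of 2, where ?'a = 'a] by (simp add: p_def)
    ultimately have "(5::'a) = 0" using r2 by simp
    then have "p dvd 5" using of_nat_eq_0_iff_char_dvd[of 5, where ?'a = 'a] by (simp add: p_def)
    then have "p = 5" using p primes_dvd_imp_eq[of p 5] by simp
    with p5 show False by simp
  qed
qed

lemma five_neq_0: "q mod 5 \<noteq> 0 \<Longrightarrow> (5::'a) \<noteq> 0"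
proof
  assume "q mod 5 \<noteq> 0" "(5::'a) = 0"
  then have "CHAR('a) dvd 5" using of_nat_eq_0_iff_char_dvd[of 5, where ?'a = 'a] by simp
  then have "CHAR('a) = 5" using primes_dvd_imp_eq[of "CHAR('a)" 5] CHAR_prime[where ?'a = 'a] by simp
  with \<open>q mod 5 \<noteq> 0\<close> q_char_power show False by auto
qed

text \<open>In terms of \<open>(x + y)\<^sup>2\<close> and \<open>x * y\<close>, the difference quotient of the quintic is a conic,
  which for \<open>T\<^sup>2 = 5 * N\<close> degenerates to a pair of conjugate lines over \<open>F (sqrt 5)\<close>.\<close>

lemma inj_on_dickson_quintic:
  assumes q5: "q mod 5 = 2 \<or> q mod 5 = 3" and TN: "T \<in> F" "N \<in> F" "N \<noteq> 0" "T\<^sup>2 = 5 * N"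
  shows "inj_on (\<lambda>t. t ^ 5 + T * t ^ 3 + N * t) F"
proof (rule inj_onI, rule ccontr)
  fix x y assume xy: "x \<in> F" "y \<in> F" "x \<noteq> y"
    and eq: "x ^ 5 + T * x ^ 3 + N * x = y ^ 5 + T * y ^ 3 + N * y"
  have form: "a = 0" if "a \<in> F" "b \<in> F" "a\<^sup>2 - 3 * (a * b) + b\<^sup>2 = 0" for a b
  proof (rule ccontr)
    assume "a \<noteq> 0"
    then have "(b / a)\<^sup>2 - 3 * (b / a) + 1 = 0"
      using that(3) by (simp add: field_simps power2_eq_square)
    with no_root_in_F[OF q5] F_divide that show False by blast
  qed
  have five: "(5::'a) \<noteq> 0" using q5 by (intro five_neq_0) auto
  \<comment> \<open>Up to the factor 5, the coordinates of \<open>((x + y)\<^sup>2, x * y)\<close>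
    relative to the centre \<open>(- T / 5, T / 5)\<close> of the conic.\<close>
  define u v where "u = 5 * (x + y)\<^sup>2 + T" and "v = 5 * (x * y) - T"
  have uv: "u \<in> F" "v \<in> F" using xy TN by (auto simp: u_def v_def intro!: F_intros)
  have "(x - y) * (u\<^sup>2 - 3 * (u * v) + v\<^sup>2) =
      25 * (x ^ 5 + T * x ^ 3 + N * x - (y ^ 5 + T * y ^ 3 + N * y)) + (x - y) * 5 * (T\<^sup>2 - 5 * N)"
    by (simp add: u_def v_def eval_nat_numeral algebra_simps)
  also have "\<dots> = 0" using eq TN by simp
  finally have "u\<^sup>2 - 3 * (u * v) + v\<^sup>2 = 0" using xy by simp
  moreover from this have "v\<^sup>2 - 3 * (v * u) + u\<^sup>2 = 0" by (simp add: algebra_simps)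
  ultimately have "u = 0" "v = 0" using form uv by blast+
  \<comment> \<open>At the centre \<open>(x + y) ^ 2 = - (x * y)\<close>, which is the same
    anisotropic form at \<open>x\<close> and \<open>- y\<close>.\<close>
  moreover have "5 * (x\<^sup>2 - 3 * (x * (- y)) + (- y)\<^sup>2) = u + v"
    by (simp add: u_def v_def power2_eq_square algebra_simps)
  ultimately have "5 * (x\<^sup>2 - 3 * (x * (- y)) + (- y)\<^sup>2) = 0" by simp
  then have *: "x\<^sup>2 - 3 * (x * (- y)) + (- y)\<^sup>2 = 0"
    using five by (simp only: mult_eq_0_iff simp_thms)
  then have "(- y)\<^sup>2 - 3 * ((- y) * x) + x\<^sup>2 = 0" by (simp add: algebra_simps)
  with * have "x = 0" "- y = 0" using form xy F_uminus by blast+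
  with xy show False by simp
qed

text \<open>The fifth power is additive here, so the quotient by \<open>v\<close> is quadratic in
  \<open>y\<close>; the square is completed with \<open>1 / 2 = 3\<close>.\<close>

lemma quintic_diff_char_5:
  fixes T N v y :: 'a
  assumes "(5::'a) = 0"
  shows "(y + v) ^ 5 + T * (y + v) ^ 3 + N * (y + v) - (y ^ 5 + T * y ^ 3 + N * y) =
    v * (v ^ 4 - T * v\<^sup>2 + N + 3 * T * (y + 3 * v)\<^sup>2)"
proof -
  have "(y + v) ^ 5 + T * (y + v) ^ 3 + N * (y + v) - (y ^ 5 + T * y ^ 3 + N * y) =
    v * (v ^ 4 - T * v\<^sup>2 + N + 3 * T * (y + 3 * v)\<^sup>2) +
    5 * (y ^ 4 * v + 2 * y ^ 3 * v\<^sup>2 + 2 * y\<^sup>2 * v ^ 3 + y * v ^ 4 - T * (3 * y * v\<^sup>2 + 5 * v ^ 3))"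
    by (simp add: eval_nat_numeral algebra_simps)
  then show ?thesis using assms by simp
qed

section \<open>Necessity by residue of q modulo 5\<close>

lemma of_nat_prime_eq_0_iff: "prime l \<Longrightarrow> (of_nat l :: 'a) = 0 \<longleftrightarrow> CHAR('a) = l"
  using primes_dvd_imp_eq[OF CHAR_prime[where ?'a = 'a]]
  by (auto simp: of_nat_eq_0_iff_char_dvd)

lemma two_eq_0_iff: "(2::'a) = 0 \<longleftrightarrow> CHAR('a) = 2"
  and three_eq_0_iff: "(3::'a) = 0 \<longleftrightarrow> CHAR('a) = 3"
  and five_eq_0_iff: "(5::'a) = 0 \<longleftrightarrow> CHAR('a) = 5"
  and seven_eq_0_iff: "(7::'a) = 0 \<longleftrightarrow> CHAR('a) = 7"
  and eleven_eq_0_iff: "(11::'a) = 0 \<longleftrightarrow> CHAR('a) = 11"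
  using of_nat_prime_eq_0_iff[of 2] of_nat_prime_eq_0_iff[of 3] of_nat_prime_eq_0_iff[of 5]
    of_nat_prime_eq_0_iff[of 7] of_nat_prime_eq_0_iff[of 11]
  by simp_all

lemma char_power_dvd_q: "CHAR('a) ^ e \<le> q \<Longrightarrow> CHAR('a) ^ e dvd q"
proof -
  assume le: "CHAR('a) ^ e \<le> q"
  obtain n where n: "q = CHAR('a) ^ n" using q_char_power by auto
  have "CHAR('a) > 1" using CHAR_prime prime_gt_1_nat by blast
  with le n have "e \<le> n" by (metis power_le_imp_le_exp)
  with n show ?thesis by (simp add: le_imp_power_dvd)
qed

text \<open>In the applications of Hermite's criterion, \<open>k\<close> is the integer \<open>(q + s) / 5\<close> for a small \<open>s\<close>.
  The next lemma computes with \<open>k = s / 5\<close> in the field; when the binomial coefficients in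
  question have denominators divisible by the characteristic,
  \<open>trinomial_coeff_reduce\<close> does so modulo a power of the characteristic.\<close>

lemma five_choose_Suc:
  assumes "5 * k = q + s"
  shows "5 * of_nat (Suc j) * (of_nat (k choose Suc j) :: 'a) =
    (of_nat s - 5 * of_nat j) * of_nat (k choose j)"
proof -
  have "Suc j * (k choose Suc j) = (k - j) * (k choose j)"
    by (simp only: binomial_absorption binomial_absorb_comp)
  then have "of_nat (Suc j) * (of_nat (k choose Suc j) :: 'a) = of_nat (k - j) * of_nat (k choose j)"
    by (metis of_nat_mult)
  also have "\<dots> = (of_nat k - of_nat j) * of_nat (k choose j)"
    by (cases "j \<le> k") (simp_all add: of_nat_diff binomial_eq_0)
  finally have *: "of_nat (Suc j) * (of_nat (k choose Suc j) :: 'a) =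
      (of_nat k - of_nat j) * of_nat (k choose j)" .
  have "5 * of_nat (Suc j) * (of_nat (k choose Suc j) :: 'a) =
      (5 * of_nat k - 5 * of_nat j) * of_nat (k choose j)"
    by (simp only: mult.assoc * right_diff_distrib[symmetric])
  also have "5 * (of_nat k :: 'a) = of_nat (q + s)"
    by (simp flip: assms)
  finally show ?thesis by simp
qed

lemma trinomial_coeff_reduce:
  fixes T N :: 'a
  assumes "r = CHAR('a) ^ e" "r \<le> q" "m < r" "\<not> 5 dvd r" "5 * k = q + s" "[5 * k' = s] (mod r)"
  shows "trinomial_coeff T N k m = trinomial_coeff T N k' m"
proof -
  have "r dvd q" using char_power_dvd_q assms(1,2) by blast
  then have "[q + s = 0 + s] (mod r)" by (intro cong_add) (auto simp: cong_0_iff)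
  with assms(5,6) have "[5 * k = 5 * k'] (mod r)" using cong_sym cong_trans by fastforce
  moreover have "coprime 5 r" using assms(4) by (intro prime_imp_coprime) auto
  ultimately have "k mod r = k' mod r" by (simp add: cong_mult_lcancel_nat flip: cong_def)
  then show ?thesis
    using trinomial_coeff_mod_char_power[OF CHAR_prime assms(1,3)] by metis
qed

context
  fixes T N :: 'a
  assumes TN: "T \<in> F" "N \<in> F" "N \<noteq> 0"
    and inj: "inj_on (\<lambda>t. t ^ 5 + T * t ^ 3 + N * t) F"
begin

lemmas hermite = hermite_single[OF TN(1,2) inj]

lemmas eval_trinomial_coeff =
  trinomial_coeff_eq_sum atMost_nat_numeral binomial_fact' fact_numeral binomial_eq_0

text \<open>At \<open>k = (q - 1) / 5\<close> the isolated coefficient is the constant term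
  1.\<close>

lemma q_mod_5_neq_1: "q mod 5 \<noteq> 1"
proof
  assume "q mod 5 = 1"
  then obtain k where k: "q = 5 * k + 1" by (metis mult_div_mod_eq)
  with q_gt_1 have "trinomial_coeff T N k 0 = 0" by (intro hermite) auto
  then show False by (simp add: trinomial_coeff_eq_sum)
qed

lemma T_eq_0_if_q_mod_5_eq_4:
  assumes "q mod 5 = 4"
  shows "T = 0"
proof -
  define k where "k = (q + 1) div 5"
  have k: "5 * k = q + 1" using assms unfolding k_def by presburger
  moreover have "q \<ge> 4" using assms by presburger
  ultimately have "trinomial_coeff T N k 1 = 0" by (intro hermite) auto
  then have "of_nat k * T = 0" by (simp add: trinomial_coeff_eq_sum)
  then have "5 * of_nat k * T = 0" by (simp add: mult.assoc)
  also have "5 * of_nat k = (1 :: 'a)" using five_choose_Suc[OF k, of 0] by simp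
  finally show ?thesis by simp
qed

text \<open>As \<open>T = 0\<close>, only even indices carry information, and \<open>m = 6\<close>,
  from \<open>s = 11\<close>, is the first available. With \<open>k = 11 / 5\<close>,
  \<open>k choose 3\<close> is \<open>11 / 125\<close>; characteristic 11 is ruled out by the
  residue of \<open>q\<close>, and characteristic 3 needs the reduction modulo 9.\<close>

lemma q_eq_9_if_q_mod_5_eq_4:
  assumes "q mod 5 = 4" "odd q"
  shows "q = 9 \<and> N\<^sup>2 = - 1"
proof -
  note T0 = T_eq_0_if_q_mod_5_eq_4[OF assms(1)]
  have q9: "q \<ge> 9" using assms by presburger
  define k where "k = (q + 11) div 5"
  have k: "5 * k = q + 11" using assms unfolding k_def by presburger
  have coeff: "trinomial_coeff T N k 6 = of_nat (k choose 3) * N ^ 3"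
    using trinomial_coeff_T_0[of N k 3] T0 by simp
  obtain n where n: "q = CHAR('a) ^ n" "n > 0" using q_char_power by auto
  have not2: "CHAR('a) \<noteq> 2" using n assms by auto
  have not11: "CHAR('a) \<noteq> 11"
  proof
    assume "CHAR('a) = 11"
    then show False using n assms power_mod[of "11::nat" 5 n] by simp
  qed
  have nz: "of_nat (k choose 3) \<noteq> (0 :: 'a)"
  proof (cases "CHAR('a) = 3")
    case True
    have "trinomial_coeff T N k 6 = trinomial_coeff T N 4 6"
      using True q9 by (intro trinomial_coeff_reduce[OF _ _ _ _ k, of 9 2]) (auto simp: cong_def)
    also have "\<dots> = 4 * N ^ 3"
      using T0 by (simp add: eval_trinomial_coeff)
    also have "(4::'a) = 1 + 3" by simp
    also have "(3::'a) = 0" using True by (simp add: three_eq_0_iff)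
    finally show ?thesis using coeff TN(3) by auto
  next
    case False
    note c = five_choose_Suc[OF k]
    have c0: "5 * of_nat k = (11 :: 'a)" using c[of 0] by simp
    have c1: "10 * of_nat (k choose 2) = 6 * (of_nat k :: 'a)"
      using c[of 1] by (simp add: numeral_2_eq_2[symmetric])
    have c2: "15 * of_nat (k choose 3) = (of_nat (k choose 2) :: 'a)"
      using c[of 2] by (simp add: numeral_3_eq_3[symmetric])
    show ?thesis
    proof
      assume "of_nat (k choose 3) = (0 :: 'a)"
      with c2 have "of_nat (k choose 2) = (0 :: 'a)" by simp
      with c1 have "2 * (3 * (of_nat k :: 'a)) = 0" by simp
      then have "(of_nat k :: 'a) = 0"
        using False not2 two_eq_0_iff three_eq_0_iff by (auto simp only: mult_eq_0_iff)
      with c0 have "(11 :: 'a) = 0" by simp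
      with not11 show False using eleven_eq_0_iff by blast
    qed
  qed
  have q: "q = 9"
  proof (rule ccontr)
    assume "q \<noteq> 9"
    then have "q > 13" using assms q9 by presburger
    then have "trinomial_coeff T N k 6 = 0" using k by (intro hermite) auto
    with nz coeff TN(3) show False by auto
  qed
  with k have k4: "k = 4" by simp
  \<comment> \<open>For \<open>q = 9\<close> both exponents 16 and 8 are multiples of
    \<open>q - 1\<close>, so only a sum of two coefficients vanishes.\<close>
  have "m \<le> 2 * 4 \<and> 9 - 1 dvd 5 * 4 - 2 * m \<longleftrightarrow> m = 2 \<or> m = 6" for m :: nat
    by presburger
  then have "{m. m \<le> 2 * k \<and> (q - 1) dvd (5 * k - 2 * m)} = {2, 6}"
    unfolding k4 q by blast
  then have "trinomial_coeff T N k 2 + trinomial_coeff T N k 6 = 0"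
    using hermite_criterion[OF TN(1,2) inj, of k] q k4 by simp
  then have "4 * N + 4 * N ^ 3 = 0"
    using T0 k4 by (simp add: eval_trinomial_coeff)
  then have "2 * (2 * (N * (N\<^sup>2 + 1))) = 0"
    by (simp add: algebra_simps eval_nat_numeral)
  then have "N\<^sup>2 + 1 = 0"
    using not2 TN(3) two_eq_0_iff by (auto simp only: mult_eq_0_iff)
  then show ?thesis using q by (simp add: eq_neg_iff_add_eq_0)
qed

text \<open>For \<open>k = 3 / 5\<close> the coefficient with index 2 is
  \<open>k * (N - T ^ 2 / 5)\<close>, which settles all characteristics except 2 (denominator) and 3
  (where \<open>k = 0\<close>).\<close>

lemma dickson_if_q_mod_5_eq_2:
  assumes q5: "q mod 5 = 2" and "q \<noteq> 2"
  shows "T\<^sup>2 = 5 * N"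
proof -
  have q7: "q \<ge> 7" using assms by presburger
  obtain n where n: "q = CHAR('a) ^ n" "n > 0" using q_char_power by auto
  define k where "k = (q + 3) div 5"
  have k: "5 * k = q + 3" using assms unfolding k_def by presburger
  have coeff: "trinomial_coeff T N k 2 = 0" using k q7 by (intro hermite) auto
  consider "CHAR('a) = 2" | "CHAR('a) = 3" | "CHAR('a) \<noteq> 2" "CHAR('a) \<noteq> 3" by blast
  then show ?thesis
  proof cases
    case 1
    then have two: "(2::'a) = 0" by (simp add: two_eq_0_iff)
    have "trinomial_coeff T N k 2 = trinomial_coeff T N 3 2"
      using 1 q7 by (intro trinomial_coeff_reduce[OF _ _ _ _ k, of 4 2]) (auto simp: cong_def)
    also have "\<dots> = 3 * T\<^sup>2 + 3 * N" by (simp add: eval_trinomial_coeff)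
    also have "\<dots> = T\<^sup>2 - 5 * N + 2 * (T\<^sup>2 + 4 * N)" by (simp add: algebra_simps)
    finally show ?thesis using two coeff by simp
  next
    \<comment> \<open>In characteristic 3 the coefficient with index 2 vanishes identically, so
      \<open>m = 7\<close> takes over. It has a factor \<open>T\<close>, excluded separately, and a
      sum of two squares, excluded because \<open>q mod 20 = 7\<close> makes -1 a
      non-square.\<close>
    case 2
    then have three: "(3::'a) = 0" by (simp add: three_eq_0_iff)
    have mod20: "3 ^ i mod 20 \<in> {1, 3, 9, 7::nat}" for i
    proof (induction i)
      case (Suc i)
      have "3 ^ Suc i mod 20 = 3 * (3 ^ i mod 20) mod (20::nat)" by (simp add: mod_mult_right_eq)
      with Suc show ?case by auto
    qed simp
    have "q mod 20 mod 5 = 2" using q5 by (simp add: mod_mod_cancel)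
    then have q20: "q mod 20 = 7" using mod20[of n] n 2 by auto
    have "3 dvd q" using char_power_dvd_q[of 1] 2 q7 by simp
    then have "q \<noteq> 7" by auto
    with q20 have q27: "q \<ge> 27" by presburger
    have "T \<noteq> 0"
    proof
      assume T0: "T = 0"
      \<comment> \<open>With \<open>T = 0\<close> only even \<open>m\<close> helps;
        \<open>m = 22\<close> is the first whose binomial is not divisible by 3, as
        \<open>m = 2\<close> and \<open>m = 12\<close> reduce to 6 and 210.\<close>
      define l where "l = (q + 43) div 5"
      have l: "5 * l = q + 43" using q5 unfolding l_def by presburger
      have "trinomial_coeff T N l 22 = trinomial_coeff T N 14 22"
        using 2 q27 by (intro trinomial_coeff_reduce[OF _ _ _ _ l, of 27 3]) (auto simp: cong_def)
      also have "\<dots> = 364 * N ^ 11"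
        using T0 trinomial_coeff_T_0[of N 14 11] by (simp add: binomial_fact' fact_numeral)
      also have "(364::'a) = 1 + 3 * 121" by simp
      finally have nz: "trinomial_coeff T N l 22 \<noteq> 0" using three TN(3) by simp
      show False
      proof (cases "q = 27")
        \<comment> \<open>Here \<open>q > 45\<close> fails and a second index 9 enters Hermite's
          sum, but it is odd and contributes 0.\<close>
        case True
        then have l14: "l = 14" using l by simp
        have "m \<le> 2 * 14 \<and> 27 - 1 dvd 5 * 14 - 2 * m \<longleftrightarrow> m = 9 \<or> m = 22" for m :: nat
          by presburger
        then have "{m. m \<le> 2 * l \<and> (q - 1) dvd (5 * l - 2 * m)} = {9, 22}"
          unfolding l14 True by blast
        then have "trinomial_coeff T N l 9 + trinomial_coeff T N l 22 = 0"
          using hermite_criterion[OF TN(1,2) inj, of l] True l14 by simp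
        moreover have "trinomial_coeff T N l 9 = 0"
          using T0 by (simp add: trinomial_coeff_T_0_odd)
        ultimately show False using nz by simp
      next
        case False
        with q20 q27 have "q > 45" by presburger
        then have "trinomial_coeff T N l 22 = 0" using l by (intro hermite) auto
        with nz show False by simp
      qed
    qed
    define x where "x = T\<^sup>2"
    define l where "l = (q + 13) div 5"
    have l: "5 * l = q + 13" using q5 unfolding l_def by presburger
    have "trinomial_coeff T N l 7 = trinomial_coeff T N 8 7"
      using 2 q27 by (intro trinomial_coeff_reduce[OF _ _ _ _ l, of 27 3]) (auto simp: cong_def)
    also have "\<dots> = 8 * T ^ 7 + 168 * (T ^ 5 * N) + 560 * (T ^ 3 * N\<^sup>2) + 280 * (T * N ^ 3)"
      by (simp add: eval_trinomial_coeff)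
    also have "\<dots> = T * (8 * x ^ 3 + 168 * (x\<^sup>2 * N) + 560 * (x * N\<^sup>2) + 280 * N ^ 3)"
      by (simp add: x_def algebra_simps eval_nat_numeral)
    also have "8 * x ^ 3 + 168 * (x\<^sup>2 * N) + 560 * (x * N\<^sup>2) + 280 * N ^ 3 =
        (x - 5 * N) * ((N - x)\<^sup>2 + x\<^sup>2) +
        3 * (2 * x ^ 3 + 60 * x\<^sup>2 * N + 183 * x * N\<^sup>2 + 95 * N ^ 3)"
      by (simp add: algebra_simps eval_nat_numeral)
    finally have "T * ((x - 5 * N) * ((N - x)\<^sup>2 + x\<^sup>2)) = 0"
      using three hermite[of l 7] l q27 by simp
    moreover have "(N - x)\<^sup>2 + x\<^sup>2 \<noteq> 0"
    proof
      assume sq: "(N - x)\<^sup>2 + x\<^sup>2 = 0"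
      have "x \<noteq> 0" using \<open>T \<noteq> 0\<close> by (simp add: x_def)
      define w where "w = (N - x) / x"
      have w: "w\<^sup>2 = - 1"
        using sq \<open>x \<noteq> 0\<close> by (simp add: w_def power_divide eq_neg_iff_add_eq_0 divide_add_eq_iff)
      have "q - 1 = 2 * ((q - 1) div 2)" "odd ((q - 1) div 2)" using q20 by presburger+
      then have "w ^ (q - 1) = - 1" by (metis w power_mult power_minus_odd power_one)
      moreover have "w \<in> F" using TN by (auto simp: w_def x_def intro!: F_intros)
      moreover have "w \<noteq> 0" using w by auto
      ultimately have "(1::'a) = - 1" using F_power_q_minus_1 by metis
      then have "(1::'a) + 1 = 0" by (simp only: eq_neg_iff_add_eq_0)
      then show False using two_eq_0_iff 2 by simp
    qed
    ultimately show ?thesis using \<open>T \<noteq> 0\<close> by (simp add: x_def)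
  next
    case 3
    have c0: "5 * of_nat k = (3 :: 'a)" using five_choose_Suc[OF k, of 0] by simp
    have c1: "2 * (5 * of_nat (k choose 2)) = - 2 * (of_nat k :: 'a)"
      using five_choose_Suc[OF k, of 1] by (simp add: numeral_2_eq_2[symmetric])
    have "2 * (5 * of_nat (k choose 2) + (of_nat k :: 'a)) = 0"
      using c1 by (simp add: algebra_simps)
    then have c1': "5 * of_nat (k choose 2) + (of_nat k :: 'a) = 0"
      using 3 two_eq_0_iff by (auto simp only: mult_eq_0_iff)
    have k0: "(of_nat k :: 'a) \<noteq> 0" using c0 3 three_eq_0_iff by auto
    have "of_nat (k choose 2) * T\<^sup>2 + of_nat k * N = 0"
      using coeff by (simp add: eval_trinomial_coeff)
    moreover have "of_nat k * (5 * N - T\<^sup>2) = 5 * (of_nat (k choose 2) * T\<^sup>2 + of_nat k * N)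
        - (5 * of_nat (k choose 2) + of_nat k) * T\<^sup>2"
      by (simp add: algebra_simps)
    ultimately have "of_nat k * (5 * N - T\<^sup>2) = 0" using c1' by simp
    then show ?thesis using k0 by simp
  qed
qed

text \<open>Away from characteristics 2, 3 and 7, the coefficient with index 4, where
  \<open>k = 7 / 5\<close>, is a unit times \<open>(5 * N - T ^ 2) * (5 * N - 2 * T ^ 2)\<close>.
  Index 9, with \<open>l = 17 / 5\<close>, removes the second factor unless \<open>17 = 0\<close> or
  \<open>q > 19\<close> fails, which leaves \<open>q = 13\<close>.\<close>

lemma dickson_if_q_mod_5_eq_3:
  assumes q5: "q mod 5 = 3" and "q \<noteq> 3"
  shows "T\<^sup>2 = 5 * N \<or> 5 * N = 2 * T\<^sup>2 \<and> ((17::'a) = 0 \<or> q = 13)"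
proof -
  have q8: "q \<ge> 8" using assms by presburger
  obtain n where n: "q = CHAR('a) ^ n" "n > 0" using q_char_power by auto
  have five: "(5::'a) \<noteq> 0" using q5 by (intro five_neq_0) auto
  define k where "k = (q + 7) div 5"
  have k: "5 * k = q + 7" using q5 unfolding k_def by presburger
  define l where "l = (q + 17) div 5"
  have l: "5 * l = q + 17" using q5 unfolding l_def by presburger
  have k_coeff: "trinomial_coeff T N k 4 = 0"
  proof (cases "q = 8")
    \<comment> \<open>Here \<open>5 * k = 15\<close> is not below \<open>2 * (q - 1) = 14\<close>,
      yet \<open>15 - 2 * m\<close> is odd and never 14.\<close>
    case True
    then have k3: "k = 3" using k by simp
    have "m \<le> 2 * 3 \<and> 8 - 1 dvd 5 * 3 - 2 * m \<longleftrightarrow> m = 4" for m :: nat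
      by presburger
    then have "{m. m \<le> 2 * k \<and> (q - 1) dvd (5 * k - 2 * m)} = {4}"
      unfolding k3 True by blast
    then show ?thesis
      using hermite_criterion[OF TN(1,2) inj, of k] True k3 by simp
  next
    case False
    with q8 q5 have "q > 9" by presburger
    then show ?thesis using k by (intro hermite) auto
  qed
  have l_coeff: "trinomial_coeff T N l 9 = 0" if "q > 19"
    using l that by (intro hermite) auto
  consider "CHAR('a) = 2" | "CHAR('a) = 3" | "CHAR('a) = 7"
    | "CHAR('a) \<noteq> 2" "CHAR('a) \<noteq> 3" "CHAR('a) \<noteq> 7" by blast
  then show ?thesis
  proof cases
    case 1
    then have two: "(2::'a) = 0" by (simp add: two_eq_0_iff)
    have "trinomial_coeff T N k 4 = trinomial_coeff T N 3 4"
      using 1 q8 by (intro trinomial_coeff_reduce[OF _ _ _ _ k, of 8 3]) (auto simp: cong_def)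
    also have "\<dots> = 3 * (T\<^sup>2 * N) + 3 * N\<^sup>2" by (simp add: eval_trinomial_coeff)
    also have "\<dots> = N * (T\<^sup>2 - 5 * N) + 2 * (T\<^sup>2 * N + 4 * N\<^sup>2)"
      by (simp add: algebra_simps power2_eq_square)
    finally show ?thesis using two k_coeff TN(3) by simp
  next
    case 2
    then have three: "(3::'a) = 0" by (simp add: three_eq_0_iff)
    have "3 dvd q" using char_power_dvd_q[of 1] 2 q8 by simp
    then have "q \<ge> 9" using q8 by presburger
    then have "9 dvd q" using char_power_dvd_q[of 2] 2 by simp
    moreover have "odd q" using n 2 by simp
    ultimately have q27: "q \<ge> 27" using q5 by presburger
    have "trinomial_coeff T N k 4 = trinomial_coeff T N 5 4"
      using 2 q27 by (intro trinomial_coeff_reduce[OF _ _ _ _ k, of 9 2]) (auto simp: cong_def)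
    also have "\<dots> = 5 * T ^ 4 + 30 * (T\<^sup>2 * N) + 10 * N\<^sup>2"
      by (simp add: eval_trinomial_coeff)
    also have "\<dots> = (T\<^sup>2 - 5 * N) * (N - T\<^sup>2) + 3 * (2 * T ^ 4 + 8 * T\<^sup>2 * N + 5 * N\<^sup>2)"
      by (simp add: algebra_simps eval_nat_numeral)
    finally have "T\<^sup>2 = 5 * N \<or> N = T\<^sup>2" using three k_coeff by simp
    moreover have "N \<noteq> T\<^sup>2"
    proof
      assume N: "N = T\<^sup>2"
      have "trinomial_coeff T N l 9 = trinomial_coeff T N 25 9"
        using 2 q27 by (intro trinomial_coeff_reduce[OF _ _ _ _ l, of 27 3]) (auto simp: cong_def)
      also have "\<dots> = 2042975 * T ^ 9 + 8652600 * (T ^ 7 * N) + 10094700 * (T ^ 5 * N\<^sup>2)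
          + 3542000 * (T ^ 3 * N ^ 3) + 265650 * (T * N ^ 4)"
        by (simp add: eval_trinomial_coeff)
      also have "\<dots> = T ^ 9 + 3 * (8199308 * T ^ 9)"
        by (simp add: N algebra_simps eval_nat_numeral)
      finally show False using l_coeff q27 three TN(3) N by simp
    qed
    ultimately show ?thesis by simp
  next
    \<comment> \<open>In characteristic 7, \<open>k\<close> is 0 and index 4 gives nothing, so index
      9 must yield the relation itself; \<open>T = 0\<close> is refuted by the even index
      14.\<close>
    case 3
    then have seven: "(7::'a) = 0" by (simp add: seven_eq_0_iff)
    have "n \<noteq> 1" "n \<noteq> 2" using q5 n 3 by auto
    with n have "n \<ge> 3" by simp
    then have "7 ^ 3 \<le> q" using n 3 by (metis power_increasing one_le_numeral)
    then have q343: "q \<ge> 343" by simp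
    have "trinomial_coeff T N l 9 = trinomial_coeff T N 23 9"
      using 3 q343 by (intro trinomial_coeff_reduce[OF _ _ _ _ l, of 49 2]) (auto simp: cong_def)
    also have "\<dots> = 817190 * T ^ 9 + 3922512 * (T ^ 7 * N) + 5148297 * (T ^ 5 * N\<^sup>2)
        + 2018940 * (T ^ 3 * N ^ 3) + 168245 * (T * N ^ 4)"
      by (simp add: eval_trinomial_coeff)
    also have "\<dots> = 3 * (T ^ 7 * (T\<^sup>2 - 5 * N)) + 7 * (116741 * T ^ 9 + 560361 * (T ^ 7 * N)
        + 735471 * (T ^ 5 * N\<^sup>2) + 288420 * (T ^ 3 * N ^ 3) + 24035 * (T * N ^ 4))"
      by (simp add: algebra_simps eval_nat_numeral)
    finally have "3 * (T ^ 7 * (T\<^sup>2 - 5 * N)) = 0" using l_coeff q343 seven by simp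
    moreover have "(3::'a) \<noteq> 0" using 3 three_eq_0_iff by simp
    ultimately have "T ^ 7 * (T\<^sup>2 - 5 * N) = 0" by (simp only: mult_eq_0_iff simp_thms)
    moreover have "T \<noteq> 0"
    proof
      assume T0: "T = 0"
      define j where "j = (q + 27) div 5"
      have j: "5 * j = q + 27" using q5 unfolding j_def by presburger
      have "trinomial_coeff T N j 14 = trinomial_coeff T N 25 14"
        using 3 q343 by (intro trinomial_coeff_reduce[OF _ _ _ _ j, of 49 2]) (auto simp: cong_def)
      also have "\<dots> = 480700 * N ^ 7"
        using T0 trinomial_coeff_T_0[of N 25 7] by (simp add: binomial_fact' fact_numeral)
      also have "\<dots> = 3 * N ^ 7 + 7 * (68671 * N ^ 7)" by simp
      finally have "3 * N ^ 7 = 0" using hermite[of j 14] j q343 seven by simp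
      with TN(3) \<open>(3::'a) \<noteq> 0\<close> show False by simp
    qed
    ultimately show ?thesis by simp
  next
    case 4
    have nz: "(2::'a) \<noteq> 0" "(3::'a) \<noteq> 0" "(7::'a) \<noteq> 0"
      using 4 two_eq_0_iff three_eq_0_iff seven_eq_0_iff by auto
    have cancel2: "2 * x = 2 * y \<Longrightarrow> x = y" and cancel3: "3 * x = 3 * y \<Longrightarrow> x = y" for x y :: 'a
      using nz by (simp_all only: mult_cancel_left simp_thms)
    define c where "c j = (of_nat (k choose j) :: 'a)" for j
    note c_rec = five_choose_Suc[OF k, folded c_def]
    have c1: "5 * c 1 = 7" using c_rec[of 0] by (simp add: c_def)
    have c2: "5 * c 2 = c 1"
      by (rule cancel2) (use c_rec[of 1] in \<open>simp add: numeral_2_eq_2[symmetric]\<close>)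
    have c3: "5 * c 3 = - c 2"
      by (rule cancel3) (use c_rec[of 2] in \<open>simp add: numeral_3_eq_3[symmetric]\<close>)
    have c4: "5 * c 4 = - 2 * c 3"
      by (rule cancel2, rule cancel2) (use c_rec[of 3] in \<open>simp add: eval_nat_numeral\<close>)
    have c2_nz: "c 2 \<noteq> 0" using c1 c2 nz by auto
    have "c 4 * T ^ 4 + c 3 * 3 * (T\<^sup>2 * N) + c 2 * N\<^sup>2 = 0"
      using k_coeff by (simp add: eval_trinomial_coeff c_def add.assoc)
    moreover have "c 2 * ((5 * N - T\<^sup>2) * (5 * N - 2 * T\<^sup>2)) =
        25 * (c 4 * T ^ 4 + c 3 * 3 * (T\<^sup>2 * N) + c 2 * N\<^sup>2)
        - 5 * T ^ 4 * (5 * c 4 + 2 * c 3) + (2 * T ^ 4 - 15 * T\<^sup>2 * N) * (5 * c 3 + c 2)"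
      by (simp add: algebra_simps eval_nat_numeral)
    ultimately have "c 2 * ((5 * N - T\<^sup>2) * (5 * N - 2 * T\<^sup>2)) = 0"
      using c3 c4 by simp
    with c2_nz have TN_cases: "T\<^sup>2 = 5 * N \<or> 5 * N = 2 * T\<^sup>2" by auto
    have "(17::'a) = 0" if N: "5 * N = 2 * T\<^sup>2" and "q \<noteq> 13"
    proof -
      have "odd (CHAR('a))" using CHAR_prime[where ?'a = 'a] 4 primes_dvd_imp_eq[of 2 "CHAR('a)"] by auto
      then have "odd q" using n by simp
      then have q19: "q > 19" using \<open>q \<noteq> 13\<close> q8 q5 by presburger
      have T0: "T \<noteq> 0" using N TN(3) five by auto
      define d where "d j = (of_nat (l choose j) :: 'a)" for j
      note d_rec = five_choose_Suc[OF l, folded d_def]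
      have d1: "5 * d 1 = 17" using d_rec[of 0] by (simp add: d_def)
      have d2: "10 * d 2 = 12 * d 1" using d_rec[of 1] by (simp add: numeral_2_eq_2[symmetric])
      have d3: "15 * d 3 = 7 * d 2" using d_rec[of 2] by (simp add: numeral_3_eq_3[symmetric])
      have d4: "20 * d 4 = 2 * d 3" using d_rec[of 3] by (simp add: eval_nat_numeral)
      have d5: "25 * d 5 = - 3 * d 4" using d_rec[of 4] by (simp add: eval_nat_numeral)
      have d6: "2 * (15 * d 6 + 4 * d 5) = 0" using d_rec[of 5] by (simp add: eval_nat_numeral)
      have d7: "35 * d 7 + 13 * d 6 = 0" using d_rec[of 6] by (simp add: eval_nat_numeral)
      have d8: "2 * (20 * d 8 + 9 * d 7) = 0" using d_rec[of 7] by (simp add: eval_nat_numeral)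
      have d9: "45 * d 9 + 23 * d 8 = 0" using d_rec[of 8] by (simp add: eval_nat_numeral)
      have d68: "15 * d 6 + 4 * d 5 = 0" "20 * d 8 + 9 * d 7 = 0"
        using d6 d8 nz(1) by (simp_all only: mult_eq_0_iff simp_thms)
      have "d 9 * T ^ 9 + d 8 * 8 * (T ^ 7 * N) + d 7 * 21 * (T ^ 5 * N\<^sup>2)
          + d 6 * 20 * (T ^ 3 * N ^ 3) + d 5 * 5 * (T * N ^ 4) = 0"
        using l_coeff q19 by (simp add: eval_trinomial_coeff d_def add.assoc)
      \<comment> \<open>The factor \<open>5 ^ 4\<close> pairs every \<open>N\<close> with a 5, so
        that \<open>5 * N = 2 * T ^ 2\<close> can be substituted.\<close>
      then have "5 ^ 4 * (d 9 * T ^ 9 + d 8 * 8 * (T ^ 7 * N) + d 7 * 21 * (T ^ 5 * N\<^sup>2)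
          + d 6 * 20 * (T ^ 3 * N ^ 3) + d 5 * 5 * (T * N ^ 4)) = 0" by simp
      also have "5 ^ 4 * (d 9 * T ^ 9 + d 8 * 8 * (T ^ 7 * N) + d 7 * 21 * (T ^ 5 * N\<^sup>2)
          + d 6 * 20 * (T ^ 3 * N ^ 3) + d 5 * 5 * (T * N ^ 4)) =
          5 ^ 4 * d 9 * T ^ 9 + d 8 * 8 * 5 ^ 3 * (T ^ 7 * (5 * N)) + d 7 * 21 * 5\<^sup>2 * (T ^ 5 * (5 * N)\<^sup>2)
          + d 6 * 20 * 5 * (T ^ 3 * (5 * N) ^ 3) + d 5 * 5 * (T * (5 * N) ^ 4)"
        by (simp add: algebra_simps power_mult_distrib)
      also have "\<dots> = 5 * T ^ 9 * (125 * d 9 + 400 * d 8 + 420 * d 7 + 160 * d 6 + 16 * d 5)"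
      proof -
        have "5 ^ 4 * e\<^sub>9 * T ^ 9 + e\<^sub>8 * 8 * 5 ^ 3 * (T ^ 7 * (2 * T\<^sup>2))
            + e\<^sub>7 * 21 * 5\<^sup>2 * (T ^ 5 * (2 * T\<^sup>2)\<^sup>2)
            + e\<^sub>6 * 20 * 5 * (T ^ 3 * (2 * T\<^sup>2) ^ 3) + e\<^sub>5 * 5 * (T * (2 * T\<^sup>2) ^ 4) =
            5 * T ^ 9 * (125 * e\<^sub>9 + 400 * e\<^sub>8 + 420 * e\<^sub>7 + 160 * e\<^sub>6 + 16 * e\<^sub>5)"
          for e\<^sub>5 e\<^sub>6 e\<^sub>7 e\<^sub>8 e\<^sub>9 :: 'a
          by (simp add: algebra_simps eval_nat_numeral)
        then show ?thesis unfolding N .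
      qed
      finally have rel: "125 * d 9 + 400 * d 8 + 420 * d 7 + 160 * d 6 + 16 * d 5 = 0"
        using T0 five by (simp only: mult_eq_0_iff power_eq_0_iff simp_thms)
      \<comment> \<open>Linear elimination of \<open>d 6\<close> to \<open>d 9\<close> from the
        recurrences and \<open>rel\<close>. From \<open>d 5 = 0\<close> the recurrences lead down to
        \<open>5 * d 1 = 17\<close>.\<close>
      have "2 * (2 * (3 * d 5)) = 700 * (45 * d 9 + 23 * d 8) + 4235 * (20 * d 8 + 9 * d 7)
          + 1935 * (35 * d 7 + 13 * d 6) + 1011 * (15 * d 6 + 4 * d 5)
          - 252 * (125 * d 9 + 400 * d 8 + 420 * d 7 + 160 * d 6 + 16 * d 5)"
        by (simp add: algebra_simps)
      then have "2 * (2 * (3 * d 5)) = 0" using rel d68 d7 d9 by simp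
      then have "d 5 = 0" using nz by (simp only: mult_eq_0_iff simp_thms)
      then have "d 4 = 0" using d5 nz by simp
      then have "d 3 = 0" using d4 nz by simp
      then have "d 2 = 0" using d3 nz by simp
      then have "2 * (2 * (3 * d 1)) = 0" using d2 by simp
      then have "d 1 = 0" using nz by (simp only: mult_eq_0_iff simp_thms)
      then show ?thesis using d1 by simp
    qed
    with TN_cases show ?thesis by blast
  qed
qed

end

section \<open>Characteristic 5\<close>

lemma euler_square:
  assumes "odd q" "h \<in> F" "h ^ ((q - 1) div 2) = 1"
  obtains x where "x \<in> F" "x\<^sup>2 = h" "x \<noteq> 0"
proof -
  have q: "(q - 1) = 2 * ((q - 1) div 2)" using assms(1) q_gt_1 by presburger
  have "2 * ((q - 1) div 2 * (q + 1)) = card (UNIV :: 'a set) - 1"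
    using card_field_minus_1 q by (metis mult.assoc)
  moreover have "h ^ ((q - 1) div 2 * (q + 1)) = 1" using assms(3) by (simp only: power_mult power_one)
  ultimately have "card {x. x\<^sup>2 = h} = 2" by (rule card_power_eq)
  then have "{x. x\<^sup>2 = h} \<noteq> {}" by fastforce
  then obtain x where x: "x\<^sup>2 = h" by blast
  have "(q - 1) div 2 > 0" using assms(1) q_gt_1 by presburger
  then have "h \<noteq> 0" using assms(3) by (auto simp: power_0_left)
  then have x0: "x \<noteq> 0" using x by auto
  have "x ^ (q - 1) = 1" using x assms(3) q by (metis power_mult)
  with x0 have "x \<in> F" by (simp add: F_iff_power_q_minus_1)
  with x x0 that show ?thesis by blast
qed

lemma euler_cases:
  assumes "odd q" "h \<in> F" "h \<noteq> 0"
  shows "h ^ ((q - 1) div 2) = 1 \<or> h ^ ((q - 1) div 2) = - 1"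
proof -
  have "2 * ((q - 1) div 2) = q - 1" using assms(1) q_gt_1 by presburger
  then have "(h ^ ((q - 1) div 2))\<^sup>2 = 1"
    using F_power_q_minus_1[OF assms(2,3)] by (metis power_mult mult.commute)
  then show ?thesis by (simp add: power2_eq_1_iff)
qed

text \<open>Collisions at distance \<open>v\<close> exist iff \<open>3 * (v ^ 4 - T * v\<^sup>2 + N) / T\<close> is a square, by
  \<open>quintic_diff_char_5\<close>. So injectivity makes the \<open>(q - 1) / 2\<close>-th power of
  \<open>v ^ 4 - T * v\<^sup>2 + N\<close> constant on nonzero \<open>v\<close>, and its coefficients at \<open>v ^ i\<close> and
  \<open>v ^ (i + (q - 1))\<close> cancel; \<open>i = 2, 4\<close> suffice.\<close>

lemma char_5_discriminant:
  fixes T N :: 'a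
  assumes char: "CHAR('a) = 5" and "q \<noteq> 5" and TN: "T \<in> F" "N \<in> F" "N \<noteq> 0" "T \<noteq> 0"
    and inj: "inj_on (\<lambda>t. t ^ 5 + T * t ^ 3 + N * t) F"
  shows "T\<^sup>2 = 4 * N"
proof -
  have five: "(5::'a) = 0" using char by (simp add: five_eq_0_iff)
  obtain n where n: "q = 5 ^ n" "n > 0" using q_char_power char by auto
  have "n \<noteq> 1" using n \<open>q \<noteq> 5\<close> by auto
  with n have "n \<ge> 2" by simp
  then have "25 dvd q" using n le_imp_power_dvd[of 2 n 5] by simp
  have q25: "q \<ge> 25" using \<open>25 dvd q\<close> q_gt_1 by (auto dest: dvd_imp_le)
  have odd: "odd q" using n by simp
  define M where "M = (q - 1) div 2"
  have M: "q = 2 * M + 1" using odd unfolding M_def by presburger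
  define f where "f v = v ^ 4 - T * v\<^sup>2 + N" for v
  have nonsq: "r\<^sup>2 \<noteq> 3 * f v / T" if "r \<in> F" "v \<in> F" "v \<noteq> 0" for r v
  proof
    assume r: "r\<^sup>2 = 3 * f v / T"
    define y where "y = r - 3 * v"
    have "f v + 3 * T * r\<^sup>2 = 5 * (2 * f v)" unfolding r using TN(4) by simp
    then have "(y + v) ^ 5 + T * (y + v) ^ 3 + N * (y + v) = y ^ 5 + T * y ^ 3 + N * y"
      using quintic_diff_char_5[OF five, of y v T N] five by (simp add: y_def f_def)
    moreover have y: "y \<in> F" unfolding y_def using that by (intro F_diff F_mult F_numeral)
    moreover have "y + v \<in> F" using y that by (intro F_add)
    ultimately have "y + v = y" using inj_onD[OF inj, of "y + v" y] by blast
    with that show False by simp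
  qed
  \<comment> \<open>Each \<open>3 * f v / T\<close> is a non-square with \<open>M\<close>-th power
    -1; \<open>\<delta>\<close> is that value after rescaling the polynomial to constant term 1, as
    \<open>trinomial_coeff\<close> requires.\<close>
  define \<delta> where "\<delta> = - ((T / (3 * N)) ^ M)"
  have three: "(3::'a) \<noteq> 0" using char three_eq_0_iff by simp
  let ?T = "- T / N" and ?N = "1 / N"
  have const: "(1 + ?T * v\<^sup>2 + ?N * v ^ 4) ^ M = \<delta>" if v: "v \<in> F" "v \<noteq> 0" for v
  proof -
    define h where "h = 3 * f v / T"
    have hF: "h \<in> F" using v TN unfolding h_def f_def by (intro F_intros)
    have "h \<noteq> 0" using nonsq[of 0 v] v by (auto simp: h_def)
    moreover have "h ^ M \<noteq> 1"
    proof
      assume "h ^ M = 1"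
      then obtain x where "x \<in> F" "x\<^sup>2 = h" using euler_square[OF odd hF] M_def by metis
      with nonsq v show False by (auto simp: h_def)
    qed
    ultimately have "h ^ M = - 1" using euler_cases[OF odd hF] by (auto simp: M_def)
    moreover have "1 + ?T * v\<^sup>2 + ?N * v ^ 4 = h * (T / (3 * N))"
      using TN three by (simp add: h_def f_def field_simps)
    ultimately show ?thesis by (simp only: power_mult_distrib \<delta>_def mult_minus1)
  qed
  define a where "a = trinomial_coeff ?T ?N M"
  have expand: "(1 + ?T * v\<^sup>2 + ?N * v ^ 4) ^ M = (\<Sum>e\<le>2 * M. a e * v ^ (2 * e))" for v
    using trinomial_power_expand[of ?T "v\<^sup>2" ?N M] by (simp add: a_def flip: power_mult)
  have rel: "a c + a (c + M) = 0" if c: "0 < c" "c < M" for c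
  proof -
    \<comment> \<open>The weight \<open>v ^ i\<close> moves exactly \<open>e = c\<close> and
      \<open>e = c + M\<close> to the exponents \<open>q - 1\<close> and \<open>2 * (q - 1)\<close>.
      From \<open>0 < i < q - 1\<close> the constant side sums to 0, and \<open>v = 0\<close>, where
      \<open>const\<close> says nothing, drops out.\<close>
    define i where "i = q - 1 - 2 * c"
    have i: "i > 0" "i + 2 * c = 2 * M" using c M by (auto simp: i_def)
    have "0 = \<delta> * (\<Sum>v\<in>F. v ^ i)"
      using i c M by (subst sum_power_F) (auto dest: dvd_imp_le)
    also have "\<dots> = (\<Sum>v\<in>F. v ^ i * (1 + ?T * v\<^sup>2 + ?N * v ^ 4) ^ M)"
      unfolding sum_distrib_left
    proof (rule sum.cong[OF refl])
      fix v assume "v \<in> F"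
      then show "\<delta> * v ^ i = v ^ i * (1 + ?T * v\<^sup>2 + ?N * v ^ 4) ^ M"
        using const[of v] i by (cases "v = 0") (simp_all only: mult.commute power_0_left mult_zero_left split: if_splits, auto)
    qed
    also have "\<dots> = (\<Sum>v\<in>F. \<Sum>e\<le>2 * M. a e * v ^ (2 * e + i))"
      unfolding expand by (simp add: sum_distrib_left power_add mult_ac)
    also have "\<dots> = (\<Sum>e\<le>2 * M. a e * (\<Sum>v\<in>F. v ^ (2 * e + i)))"
      by (subst sum.swap) (simp add: sum_distrib_left)
    also have "\<dots> = (\<Sum>e\<le>2 * M. if e = c \<or> e = c + M then - a e else 0)"
    proof (rule sum.cong[OF refl])
      fix e assume e: "e \<in> {..2 * M}"
      have "(q - 1) dvd (2 * e + i) \<longleftrightarrow> e = c \<or> e = c + M"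
      proof
        assume "(q - 1) dvd (2 * e + i)"
        then obtain j where "2 * e + i = 2 * M * j" using M by auto
        then have j: "e + M = c + M * j" using i by simp
        have "j > 0" using j c by (intro Nat.gr0I) auto
        moreover have "j < 3"
        proof (rule ccontr)
          assume "\<not> j < 3"
          then have "M * 3 \<le> M * j" by (intro mult_left_mono) auto
          with j e c show False by simp
        qed
        ultimately have "j = 1 \<or> j = 2" by auto
        with j show "e = c \<or> e = c + M" by auto
      next
        assume "e = c \<or> e = c + M"
        then have "2 * e + i = (q - 1) * 1 \<or> 2 * e + i = (q - 1) * 2" using i M by auto
        then show "(q - 1) dvd (2 * e + i)" by (metis dvd_triv_left)
      qed
      then show "a e * (\<Sum>v\<in>F. v ^ (2 * e + i)) = (if e = c \<or> e = c + M then - a e else 0)"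
        using i(1) by (simp add: sum_power_F)
    qed
    also have "\<dots> = (\<Sum>e\<in>{c, c + M}. - a e)"
      using c by (intro sum.mono_neutral_cong_right) auto
    also have "\<dots> = - (a c + a (c + M))" using c by simp
    finally show ?thesis by (metis neg_0_equal_iff_equal)
  qed
  \<comment> \<open>The last base 5 digit of \<open>M\<close> is 2, so \<open>P ^ M\<close> is
    \<open>P ^ 2\<close> times a fifth power. The latter lives in degrees divisible by 5 and
    \<open>P ^ 2\<close> has degree at most 4, so each coefficient is a single product.\<close>
  have "odd (5 ^ (n - 1) :: nat)" by simp
  then obtain b where "5 ^ (n - 1) = 2 * b + (1::nat)" by (elim oddE)
  moreover have "q = 5 * 5 ^ (n - 1)" using n by (simp flip: power_Suc)
  ultimately have Mb: "M = 5 * b + 2" using M by simp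
  define P where "P = [:1, ?T, ?N:]"
  have a_split: "a (5 * i + j) = coeff (P\<^sup>2) j * coeff ((P ^ b) ^ 5) (5 * i)" if "j < 5" for i j
  proof -
    have "P ^ M = P\<^sup>2 * (P ^ b) ^ 5"
      unfolding Mb by (simp only: power_add mult.commute flip: power_mult)
    then have "a (5 * i + j) = coeff (P\<^sup>2 * (P ^ b) ^ 5) (5 * i + j)"
      by (simp add: a_def trinomial_coeff_def P_def)
    also have "\<dots> = (\<Sum>s\<le>5 * i + j. coeff (P\<^sup>2) s * coeff ((P ^ b) ^ 5) (5 * i + j - s))"
      by (rule coeff_mult)
    also have "\<dots> = (\<Sum>s\<in>{j}. coeff (P\<^sup>2) s * coeff ((P ^ b) ^ 5) (5 * i + j - s))"
    proof (rule sum.mono_neutral_right)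
      show "\<forall>s\<in>{..5 * i + j} - {j}. coeff (P\<^sup>2) s * coeff ((P ^ b) ^ 5) (5 * i + j - s) = 0"
      proof
        fix s assume s: "s \<in> {..5 * i + j} - {j}"
        show "coeff (P\<^sup>2) s * coeff ((P ^ b) ^ 5) (5 * i + j - s) = 0"
        proof (cases "s < 5")
          case True
          have "\<not> 5 dvd (5 * i + j - s)"
          proof
            assume "5 dvd (5 * i + j - s)"
            then obtain d where "5 * i + j - s = 5 * d" by (elim dvdE)
            moreover have "s \<le> 5 * i + j" using s by simp
            ultimately have "5 * i + j = 5 * d + s" by linarith
            then have "(5 * i + j) mod 5 = (5 * d + s) mod 5" by simp
            then show False using True that s by simp
          qed
          then show ?thesis using coeff_power_char[of _ "P ^ b"] char by simp
        next
          case False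
          have "degree P \<le> 2" by (simp add: P_def)
          with degree_power_le[of P 2] have "degree (P\<^sup>2) \<le> 4" by linarith
          then have "coeff (P\<^sup>2) s = 0" using False by (intro coeff_eq_0) simp
          then show ?thesis by simp
        qed
      qed
    qed auto
    finally show ?thesis by simp
  qed
  have P2: "P\<^sup>2 = [:1, 2 * ?T, ?T\<^sup>2 + 2 * ?N, 2 * ?T * ?N, ?N\<^sup>2:]"
    by (simp add: P_def power2_eq_square)
  \<comment> \<open>\<open>B\<close> stays unknown but is common to both high coefficients, so the
    relations for \<open>c = 1\<close> and \<open>c = 2\<close> eliminate it. The second needs
    \<open>M > 2\<close>, hence \<open>q \<noteq> 5\<close>.\<close>
  define B where "B = coeff ((P ^ b) ^ 5) (5 * b)"
  have c0: "coeff ((P ^ b) ^ 5) 0 = 1"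
    by (simp add: coeff_0_power P_def)
  have coeffs: "coeff (P\<^sup>2) 1 = 2 * ?T" "coeff (P\<^sup>2) 2 = ?T\<^sup>2 + 2 * ?N"
      "coeff (P\<^sup>2) 3 = 2 * ?T * ?N" "coeff (P\<^sup>2) 4 = ?N\<^sup>2"
    unfolding P2 by (simp_all add: coeff_pCons numeral_eq_Suc)
  have "M > 2" using M q25 by simp
  have "1 + M = 5 * b + 3" "2 + M = 5 * b + 4" using Mb by simp_all
  then have high: "a (1 + M) = 2 * ?T * ?N * B" "a (2 + M) = ?N\<^sup>2 * B"
    using a_split[of 3 b] a_split[of 4 b] by (simp_all only: coeffs B_def)
  have "a 1 = coeff (P\<^sup>2) 1" "a 2 = coeff (P\<^sup>2) 2"
    using a_split[of 1 0] a_split[of 2 0] by (simp_all add: c0 numeral_2_eq_2)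
  then have low: "a 1 = 2 * ?T" "a 2 = ?T\<^sup>2 + 2 * ?N"
    by (simp_all only: coeffs)
  have "a 1 + a (1 + M) = 0" "a 2 + a (2 + M) = 0"
    using rel[of 1] rel[of 2] \<open>M > 2\<close> by simp_all
  then have "2 * ?T + 2 * ?T * ?N * B = 0" and *: "?T\<^sup>2 + 2 * ?N + ?N\<^sup>2 * B = 0"
    by (simp_all only: high low)
  moreover have "2 * ?T \<noteq> 0" using TN char two_eq_0_iff by simp
  moreover have "2 * ?T + 2 * ?T * ?N * B = 2 * ?T * (1 + ?N * B)"
    by (simp only: distrib_left mult_1_right mult.assoc)
  ultimately have "1 + ?N * B = 0" by (metis mult_eq_0_iff)
  moreover have "N\<^sup>2 * (?T\<^sup>2 + 2 * ?N + ?N\<^sup>2 * B) = T\<^sup>2 + N + N * (1 + ?N * B)"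
    using TN by (simp add: field_simps power2_eq_square)
  ultimately have "T\<^sup>2 + N = 0" using * by simp
  then have "T\<^sup>2 = 4 * N - 5 * N" by (simp add: eq_neg_iff_add_eq_0)
  then show ?thesis using five by simp
qed

section \<open>Exceptional cases\<close>

lemma q_mod_5_eq_0_iff: "q mod 5 = 0 \<longleftrightarrow> CHAR('a) = 5"
proof -
  obtain n where n: "q = CHAR('a) ^ n" "n > 0" using q_char_power by auto
  have "q mod 5 = 0 \<longleftrightarrow> 5 dvd CHAR('a) ^ n" using n by presburger
  also have "\<dots> \<longleftrightarrow> 5 dvd CHAR('a)" using n by (simp add: prime_dvd_power_iff)
  also have "\<dots> \<longleftrightarrow> CHAR('a) = 5" using primes_dvd_imp_eq[of 5 "CHAR('a)"] CHAR_prime by auto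
  finally show ?thesis .
qed

lemma char_eq_if_q_prime: "prime q \<Longrightarrow> CHAR('a) = q"
proof -
  assume "prime q"
  moreover obtain n where "q = CHAR('a) ^ n" "n > 0" using q_char_power by auto
  then have "CHAR('a) dvd q" by simp
  ultimately show ?thesis using primes_dvd_imp_eq CHAR_prime by blast
qed

lemma F_eq_image: "prime q \<Longrightarrow> F = of_nat ` {..<q}"
proof -
  assume "prime q"
  then have char: "CHAR('a) = q" by (rule char_eq_if_q_prime)
  have "inj_on (of_nat :: nat \<Rightarrow> 'a) {..<q}"
    by (rule inj_onI) (auto simp: of_nat_eq_iff_cong_CHAR char cong_def)
  then have "card ((of_nat :: nat \<Rightarrow> 'a) ` {..<q}) = card F"
    by (simp add: card_image card_F)
  then show ?thesis by (intro card_subset_eq[symmetric]) auto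
qed

section \<open>Translation between \<open>\<alpha>\<close> and its trace and norm; exceptional
  fields\<close>

context
  fixes \<alpha> T N :: 'a
  assumes \<alpha>: "\<alpha> \<noteq> 0" and T_def: "T = \<alpha> + \<alpha> ^ q" and N_def: "N = \<alpha> ^ (q + 1)"
begin

abbreviation "g \<equiv> \<lambda>t. t ^ 5 + T * t ^ 3 + N * t"

lemma trace_in_F: "T \<in> F" and norm_in_F': "N \<in> F" and norm_nz: "N \<noteq> 0"
  using \<alpha> norm_in_F frobenius_frobenius[of \<alpha>]
  by (simp_all add: T_def N_def F_def frobenius_add add.commute del: power_Suc)

lemmas TN = trace_in_F norm_in_F' norm_nz

lemma power_q_eq: "\<alpha> ^ q = \<alpha> * \<alpha> ^ (q - 1)"
  using q_gt_1 by (simp flip: power_Suc)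

lemma T_eq: "T = \<alpha> * (1 + \<alpha> ^ (q - 1))" and N_eq: "N = \<alpha>\<^sup>2 * \<alpha> ^ (q - 1)"
  by (simp_all add: T_def N_def power_q_eq algebra_simps power2_eq_square)

lemma discriminant: "(\<alpha> - \<alpha> ^ q)\<^sup>2 = T\<^sup>2 - 4 * N"
  by (simp add: T_def N_def power2_eq_square algebra_simps)

text \<open>With \<open>w = \<alpha> ^ (q - 1)\<close>, \<open>T ^ 2 - 5 * N\<close> is
  \<open>\<alpha> ^ 2 * (w ^ 2 - 3 * w + 1)\<close>.\<close>

lemma golden_iff: "\<alpha> ^ (2 * q - 2) - 3 * \<alpha> ^ (q - 1) + 1 = 0 \<longleftrightarrow> T\<^sup>2 = 5 * N"
proof -
  have "2 * q - 2 = (q - 1) * 2" by simp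
  then have "\<alpha> ^ (2 * q - 2) = (\<alpha> ^ (q - 1))\<^sup>2" by (simp only: power_mult)
  moreover have "T\<^sup>2 - 5 * N = \<alpha>\<^sup>2 * ((\<alpha> ^ (q - 1))\<^sup>2 - 3 * \<alpha> ^ (q - 1) + 1)"
    by (simp add: T_eq N_eq power2_eq_square algebra_simps)
  ultimately show ?thesis using \<alpha> by (metis eq_iff_diff_eq_0 mult_eq_0_iff power_eq_0_iff)
qed

lemma T_eq_0_iff: "T = 0 \<longleftrightarrow> \<alpha> ^ (q - 1) = - 1"
  using \<alpha> by (auto simp: T_eq add_eq_0_iff)

text \<open>\<open>T = 0\<close> means \<open>\<alpha> ^ (q - 1) = - 1\<close>. For odd
  \<open>q\<close> the survivor \<open>q = 9\<close>, \<open>N ^ 2 = - 1\<close> clashes with it,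
  giving \<open>\<alpha> ^ 8 = 1\<close>. For even \<open>q\<close>, \<open>\<alpha> = x ^ 2\<close>
  with \<open>x\<close> in \<open>F\<close>, and \<open>N = x ^ 4\<close> makes \<open>x\<close> a
  second zero of the quintic.\<close>

lemma not_inj_if_q_mod_5_eq_4:
  assumes q5: "q mod 5 = 4"
  shows "\<not> inj_on g F"
proof
  assume inj: "inj_on g F"
  have T0: "T = 0" by (rule T_eq_0_if_q_mod_5_eq_4[OF TN inj q5])
  then have \<alpha>1: "\<alpha> ^ (q - 1) = - 1" by (simp add: T_eq_0_iff)
  then have N: "N = - \<alpha>\<^sup>2" by (simp add: N_eq)
  show False
  proof (cases "odd q")
    case True
    from q_eq_9_if_q_mod_5_eq_4[OF TN inj q5 True] have q9: "q = 9" and "N\<^sup>2 = - 1" by auto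
    then have "\<alpha> ^ 4 = - 1" by (simp add: N flip: power_mult)
    then have "(\<alpha> ^ 4)\<^sup>2 = 1" by simp
    then have "\<alpha> ^ 8 = 1" by (simp flip: power_mult)
    with \<alpha>1 q9 have "(1::'a) = - 1" by simp
    then have "(2::'a) = 0" by (metis add_eq_0_iff one_add_one)
    moreover have "CHAR('a) \<noteq> 2" using True q_char_power by auto
    ultimately show False by (simp add: two_eq_0_iff)
  next
    case False
    obtain n where n: "q = CHAR('a) ^ n" "n > 0" using q_char_power by auto
    have "CHAR('a) = 2"
      using False n primes_dvd_imp_eq[of 2 "CHAR('a)"] CHAR_prime[where ?'a = 'a] by simp
    then have two: "(2::'a) = 0" by (simp add: two_eq_0_iff)
    then have neg: "- x = x" for x :: 'a
      by (metis add_eq_0_iff mult_2 mult_zero_left)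
    have \<alpha>F: "\<alpha> ^ q = \<alpha>" using T0 neg by (simp add: T_def add_eq_0_iff)
    define x where "x = \<alpha> ^ (q div 2)"
    have x: "x\<^sup>2 = \<alpha>" using \<alpha>F False by (simp add: x_def flip: power_mult)
    have "\<alpha> \<in> F" using \<alpha>F by (simp add: F_def)
    then have "x \<in> F" by (simp add: x_def F_power)
    moreover have "g x = g 0" using T0 N by (simp add: neg flip: x) (simp add: two eval_nat_numeral)
    ultimately have "x = 0" using inj by (auto simp: inj_on_def)
    with x \<alpha> show False by simp
  qed
qed

text \<open>In characteristic 17 the discriminant \<open>T ^ 2 - 4 * N\<close> becomes
  \<open>(8 * T) ^ 2\<close>, so its root \<open>\<alpha> - \<alpha> ^ q\<close> lies in
  \<open>F\<close>. The \<open>q\<close>-th power map also negates this root, so it is 0, forcing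
  \<open>T = 0\<close> and \<open>N = 0\<close>.\<close>

lemma seventeen_neq_0:
  assumes "5 * N = 2 * T\<^sup>2"
  shows "(17::'a) \<noteq> 0"
proof
  assume e: "(17::'a) = 0"
  define D where "D = \<alpha> - \<alpha> ^ q"
  have char: "CHAR('a) = 17"
    using e of_nat_prime_eq_0_iff[of 17] by simp
  have "D\<^sup>2 = T\<^sup>2 - 4 * N" using discriminant by (simp add: D_def)
  also have "\<dots> = 64 * T\<^sup>2 - 28 * (5 * N - 2 * T\<^sup>2) + 17 * (8 * N - 7 * T\<^sup>2)"
    by (simp add: algebra_simps)
  also have "\<dots> = (8 * T)\<^sup>2" using e assms by (simp add: power_mult_distrib)
  finally have D: "D = 8 * T \<or> D = - (8 * T)" by (rule power2_eq_iff[THEN iffD1])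
  then have "D \<in> F" using TN by (auto intro!: F_intros)
  then have "D ^ q = D" by (simp add: F_def)
  moreover have "D ^ q = - D" by (simp add: D_def frobenius_diff frobenius_frobenius)
  ultimately have "D = - D" by simp
  then have "2 * D = 0" by (simp add: eq_neg_iff_add_eq_0)
  then have "D = 0" using char two_eq_0_iff by simp
  then have "8 * T = 0" using D by auto
  then have "2 * (2 * (2 * T)) = 0" by simp
  moreover have "(2::'a) \<noteq> 0" using char two_eq_0_iff by simp
  ultimately have "T = 0" by (simp only: mult_eq_0_iff simp_thms)
  with assms have "5 * N = 0" by simp
  then show False using TN char five_eq_0_iff by simp
qed

lemma permutation_q_2:
  assumes "q = 2"
  shows "inj_on g F \<longleftrightarrow> T\<^sup>2 = 5 * N"
proof -
  have char: "CHAR('a) = 2" using char_eq_if_q_prime assms by simp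
  then have two: "(2::'a) = 0" by (simp add: two_eq_0_iff)
  have "F = of_nat ` {..<q}" by (rule F_eq_image) (simp add: assms)
  also have "{..<q} = {0, 1}" using assms by auto
  finally have F: "F = {0, 1}" by simp
  have "N = 1" using norm_nz norm_in_F' F by auto
  have "(5::'a) = 1 + 2 * 2" by simp
  then have five: "(5::'a) = 1" using two by simp
  have "T = 0 \<or> T = 1" using trace_in_F F by auto
  moreover have "1 + T + 1 = T + 2" by simp
  ultimately show ?thesis unfolding F \<open>N = 1\<close> five using two by auto
qed

text \<open>On \<open>F\<close> the quintic is multiplication by \<open>1 + T + N\<close>, the norm
  of \<open>1 + \<alpha>\<close>, so only \<open>\<alpha> = - 1\<close> fails. The other units
  satisfy \<open>\<alpha> ^ 4 = - 1\<close>, \<open>\<alpha> ^ 2 = - 1\<close> or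
  \<open>\<alpha> = 1\<close>.\<close>

lemma permutation_q_3:
  assumes q: "q = 3"
  shows "inj_on g F \<longleftrightarrow> T\<^sup>2 = 5 * N \<or> \<alpha> = 1 \<or> \<alpha>\<^sup>2 = - 1"
proof -
  have char: "CHAR('a) = 3" using char_eq_if_q_prime q by simp
  then have three: "(3::'a) = 0" by (simp add: three_eq_0_iff)
  have two: "(2::'a) \<noteq> 0" using char by (simp add: two_eq_0_iff)
  have g: "g t = (1 + T + N) * t" if "t \<in> F" for t
  proof -
    have "t ^ q = t" using that by (simp only: F_def mem_Collect_eq)
    then have t3: "t ^ 3 = t" by (simp add: q)
    have "t ^ 5 = t ^ 3 * t\<^sup>2" by (simp flip: power_add)
    also have "\<dots> = t * t\<^sup>2" by (simp only: t3)
    also have "\<dots> = t ^ 3" by (simp add: eval_nat_numeral)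
    finally show ?thesis by (simp add: t3 algebra_simps)
  qed
  have "inj_on g F \<longleftrightarrow> inj_on (\<lambda>t. (1 + T + N) * t) F"
    using g by (rule inj_on_cong)
  also have "\<dots> \<longleftrightarrow> 1 + T + N \<noteq> 0"
  proof
    assume "inj_on (\<lambda>t. (1 + T + N) * t) F"
    from inj_onD[OF this, of 0 1] show "1 + T + N \<noteq> 0" by auto
  qed (auto simp: inj_on_def)
  also have "1 + T + N = (1 + \<alpha>) * (1 + \<alpha>) ^ q"
    unfolding frobenius_add by (simp add: T_def N_def algebra_simps)
  also have "\<dots> \<noteq> 0 \<longleftrightarrow> \<alpha> \<noteq> - 1"
    by (auto simp: q add_eq_0_iff)
  also have "\<dots> \<longleftrightarrow> T\<^sup>2 = 5 * N \<or> \<alpha> = 1 \<or> \<alpha>\<^sup>2 = - 1"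
  proof -
    have "T\<^sup>2 = 5 * N \<longleftrightarrow> \<alpha> ^ 4 = - 1"
      using golden_iff three by (simp add: q eq_neg_iff_add_eq_0)
    moreover have "\<alpha> ^ 8 = 1" using unit_power[OF \<alpha>] by (simp add: q)
    then have "(\<alpha> ^ 4)\<^sup>2 = 1" by (simp flip: power_mult)
    then have "\<alpha> ^ 4 = 1 \<or> \<alpha> ^ 4 = - 1" by (rule power2_eq_1_iff[THEN iffD1])
    moreover have "\<alpha> ^ 4 = 1 \<longleftrightarrow> \<alpha>\<^sup>2 = 1 \<or> \<alpha>\<^sup>2 = - 1"
      using power2_eq_1_iff[of "\<alpha>\<^sup>2"] by (simp flip: power_mult)
    moreover have "\<alpha>\<^sup>2 = 1 \<longleftrightarrow> \<alpha> = 1 \<or> \<alpha> = - 1" by (rule power2_eq_1_iff)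
    moreover have "(1::'a) \<noteq> - 1" using two by (metis add_eq_0_iff one_add_one)
    ultimately show ?thesis by auto
  qed
  finally show ?thesis .
qed

text \<open>Modulo 13, \<open>5 * N = 2 * T ^ 2\<close> reads \<open>T ^ 2 = 9 * N\<close> and
  splits into \<open>\<beta> ^ 2 - 3 * \<beta> + 1 = 0\<close> and
  \<open>\<beta> ^ 2 + 3 * \<beta> + 1 = 0\<close> with \<open>\<beta> = \<alpha> ^ 6\<close>. The
  former makes \<open>T\<close> a non-square, the latter a square; rescaling leaves one quintic
  modulo 13 for each, and only the first permutes.\<close>

lemma permutation_q_13:
  assumes q: "q = 13"
  shows "5 * N = 2 * T\<^sup>2 \<and> inj_on g F \<longleftrightarrow> \<alpha> ^ 12 - 3 * \<alpha> ^ 6 + 1 = 0"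
proof -
  have char: "CHAR('a) = 13" using char_eq_if_q_prime q by simp
  then have t13: "(13::'a) = 0" using of_nat_prime_eq_0_iff[of 13] by simp
  have two: "(2::'a) \<noteq> 0" using char by (simp add: two_eq_0_iff)
  have one: "(1::'a) \<noteq> - 1" using two by (metis add_eq_0_iff one_add_one)
  have odd: "odd q" and half: "(q - 1) div 2 = 6" by (simp_all add: q)
  define \<beta> where "\<beta> = \<alpha> ^ 6"
  have T: "T = \<alpha> * (1 + \<beta>\<^sup>2)" and N: "N = \<alpha>\<^sup>2 * \<beta>\<^sup>2"
    by (simp_all add: T_eq N_eq q \<beta>_def flip: power_mult)
  have cond: "\<alpha> ^ 12 - 3 * \<alpha> ^ 6 + 1 = \<beta>\<^sup>2 - 3 * \<beta> + 1" by (simp add: \<beta>_def flip: power_mult)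
  have \<alpha>7: "(\<alpha> * \<beta>) ^ 6 = \<beta> ^ 7"
    by (simp add: \<beta>_def flip: power_mult power_Suc)
  \<comment> \<open>The coefficients are alternate Fibonacci numbers:
    \<open>z ^ 7 = 377 * z - 144\<close>, with \<open>377 = 13 * 29\<close> and
    \<open>144 = 13 * 11 + 1\<close>.\<close>
  have seven: "z ^ 7 = - 1" if "z\<^sup>2 = 3 * z - 1" for z :: 'a
  proof -
    have "z ^ 4 = (z\<^sup>2)\<^sup>2" by simp
    also have "\<dots> = (3 * z - 1)\<^sup>2" by (simp only: that)
    also have "\<dots> = 9 * z\<^sup>2 - 6 * z + 1" by (simp add: power2_eq_square algebra_simps)
    also have "\<dots> = 21 * z - 8" by (simp add: that)
    finally have z4: "z ^ 4 = 21 * z - 8" .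
    have "z ^ 6 = z ^ 4 * z\<^sup>2" by (simp flip: power_add)
    also have "\<dots> = (21 * z - 8) * (3 * z - 1)" by (simp only: that z4)
    also have "\<dots> = 63 * z\<^sup>2 - 45 * z + 8" by (simp add: power2_eq_square algebra_simps)
    also have "\<dots> = 144 * z - 55" by (simp add: that)
    finally have z6: "z ^ 6 = 144 * z - 55" .
    have "z ^ 7 = z ^ 6 * z" by (simp add: eval_nat_numeral)
    also have "\<dots> = (144 * z - 55) * z" by (simp only: z6)
    also have "\<dots> = 144 * z\<^sup>2 - 55 * z" by (simp add: power2_eq_square algebra_simps)
    also have "\<dots> = 13 * (29 * z - 11) - 1" by (simp add: that)
    finally show ?thesis using t13 by simp
  qed
  have p6: "(3::'a) ^ 6 = 1"
  proof -
    have "(3::'a) ^ 6 = 1 + 13 * 56" by simp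
    then show ?thesis unfolding t13 by simp
  qed
  show ?thesis unfolding cond
  proof
    assume *: "\<beta>\<^sup>2 - 3 * \<beta> + 1 = 0"
    then have \<beta>: "\<beta>\<^sup>2 = 3 * \<beta> - 1" by (simp add: algebra_simps eq_neg_iff_add_eq_0)
    have T': "T = 3 * (\<alpha> * \<beta>)" by (simp add: T \<beta>)
    have T9: "T\<^sup>2 = 9 * N" by (simp add: T' N power_mult_distrib)
    have "2 * T\<^sup>2 = 5 * N + 13 * N" unfolding T9 by simp
    then have NT: "5 * N = 2 * T\<^sup>2" using t13 by simp
    have "T ^ 6 = \<beta> ^ 7" unfolding T' power_mult_distrib[of 3] p6 by (simp only: \<alpha>7 mult_1)
    then have T6: "T ^ 6 = - 1" using seven[OF \<beta>] by simp
    \<comment> \<open>7 is a non-square modulo 13, so \<open>7 * T\<close> is a square;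
      \<open>2 * 7 = 1\<close> then writes \<open>T\<close> as \<open>2 * c ^ 2\<close>.\<close>
    have "(7 * T) ^ 6 = 117649 * T ^ 6" by (simp add: power_mult_distrib)
    also have "(117649::'a) = 13 * 9050 - 1" by simp
    finally have "(7 * T) ^ 6 = 1" using t13 T6 by simp
    then have "(7 * T) ^ ((q - 1) div 2) = 1" by (simp only: half)
    moreover have "7 * T \<in> F" using TN by (intro F_mult F_numeral)
    ultimately obtain c where c: "c \<in> F" "c\<^sup>2 = 7 * T" "c \<noteq> 0"
      using euler_square[OF odd] by blast
    have Tc: "T = 2 * c\<^sup>2 - 13 * T" unfolding c(2) by simp
    then have Tc: "T = 2 * c\<^sup>2" using t13 by simp
    have "N = 3 * T\<^sup>2 + 13 * N - 13 * (3 * N) + (9 * N - T\<^sup>2) * 3" by (simp add: algebra_simps)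
    then have "N = 3 * T\<^sup>2" using t13 T9 by simp
    then have Nc: "N = 12 * c ^ 4" by (simp add: Tc power_mult_distrib flip: power_mult)
    have gc: "g (c * s) = c ^ 5 * (s ^ 5 + 2 * s ^ 3 + 12 * s)" for s
      by (simp add: Tc Nc algebra_simps eval_nat_numeral)
    define f :: "nat \<Rightarrow> nat" where "f i = i ^ 5 + 2 * i ^ 3 + 12 * i" for i
    define r where "r = [0, 1, 2, 3, 4, 5, 6, 7, 8, 9, 10, 11, 12 :: nat]"
    have "distinct (map (\<lambda>i. f i mod 13) r)"
      by (simp add: r_def f_def)
    then have inj_r: "inj_on (\<lambda>i. f i mod 13) (set r)"
      by (simp only: distinct_map)
    have mem_r: "i \<in> set r" if "i < 13" for i
      unfolding r_def using that by (simp, presburger)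
    have inj_nat: "i = j" if "i < 13" "j < 13"
      "f i mod 13 = f j mod 13" for i j :: nat
      by (rule inj_onD[OF inj_r that(3) mem_r[OF that(1)] mem_r[OF that(2)]])
    have "inj_on g F"
    proof (rule inj_onI)
      fix x y assume xy: "x \<in> F" "y \<in> F" "g x = g y"
      obtain i where i: "x / c = of_nat i" "i < 13"
        using F_divide[OF xy(1) c(1)] F_eq_image q by auto
      obtain j where j: "y / c = of_nat j" "j < 13"
        using F_divide[OF xy(2) c(1)] F_eq_image q by auto
      have x: "x = c * of_nat i" using i c by (simp add: field_simps)
      have y: "y = c * of_nat j" using j c by (simp add: field_simps)
      have "(of_nat i :: 'a) ^ 5 + 2 * of_nat i ^ 3 + 12 * of_nat i = of_nat j ^ 5 + 2 * of_nat j ^ 3 + 12 * of_nat j"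
        using xy(3) c(3) unfolding x y gc by simp
      then have "(of_nat (f i) :: 'a) = of_nat (f j)" by (simp add: f_def)
      then have "f i mod 13 = f j mod 13"
        unfolding of_nat_eq_iff_cong_CHAR char cong_def .
      then have "i = j" by (rule inj_nat[OF i(2) j(2)])
      then show "x = y" by (simp add: x y)
    qed
    with NT show "5 * N = 2 * T\<^sup>2 \<and> inj_on g F" by blast
  next
    assume "5 * N = 2 * T\<^sup>2 \<and> inj_on g F"
    then have NT: "5 * N = 2 * T\<^sup>2" and inj: "inj_on g F" by auto
    have "T\<^sup>2 = 9 * N + 7 * (2 * T\<^sup>2 - 5 * N) - 13 * (T\<^sup>2 - 2 * N)" by (simp add: algebra_simps)
    then have T9: "T\<^sup>2 = 9 * N" using t13 NT by simp
    have "N = 3 * T\<^sup>2 + 13 * N - 13 * (3 * N) + (9 * N - T\<^sup>2) * 3" by (simp add: algebra_simps)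
    then have N3: "N = 3 * T\<^sup>2" using t13 T9 by simp
    have T0: "T \<noteq> 0" using N3 TN by auto
    have "T ^ 6 \<noteq> 1"
    proof
      assume "T ^ 6 = 1"
      then have "T ^ ((q - 1) div 2) = 1" by (simp only: half)
      then obtain c where c: "c \<in> F" "c\<^sup>2 = T" "c \<noteq> 0"
        using euler_square[OF odd trace_in_F] by blast
      have N4: "N = 3 * c ^ 4" by (simp add: N3 flip: c(2) power_mult)
      \<comment> \<open>For \<open>c = 1\<close> the values at 5 and 6 are 3265 and 8010, which
        differ by \<open>13 * 365\<close>.\<close>
      have "g (5 * c) = g (6 * c) - 13 * (365 * c ^ 5)"
        by (simp add: N4 algebra_simps eval_nat_numeral flip: c(2))
      then have "g (5 * c) = g (6 * c)" using t13 by simp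
      moreover have "5 * c \<in> F" "6 * c \<in> F" using c(1) by (simp_all add: F_mult)
      ultimately have "5 * c = 6 * c" using inj_onD[OF inj, of "5 * c" "6 * c"] by blast
      moreover have "c = 6 * c - 5 * c" by (simp add: algebra_simps)
      ultimately show False using c by simp
    qed
    have "\<alpha>\<^sup>2 * ((\<beta>\<^sup>2 - 3 * \<beta> + 1) * (\<beta>\<^sup>2 + 3 * \<beta> + 1)) = T\<^sup>2 - 9 * N"
      by (simp add: T N power2_eq_square algebra_simps)
    then consider "\<beta>\<^sup>2 - 3 * \<beta> + 1 = 0" | "\<beta>\<^sup>2 + 3 * \<beta> + 1 = 0"
      using T9 \<alpha> by auto
    then show "\<beta>\<^sup>2 - 3 * \<beta> + 1 = 0"
    proof cases
      case 2
      then have \<beta>: "(- \<beta>)\<^sup>2 = 3 * (- \<beta>) - 1" by (simp add: algebra_simps eq_neg_iff_add_eq_0)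
      have "T = 3 * (\<alpha> * (- \<beta>))" unfolding T using \<beta> by simp
      then have "T ^ 6 = 3 ^ 6 * (\<alpha> * \<beta>) ^ 6" by (simp add: power_mult_distrib)
      also have "\<dots> = \<beta> ^ 7" by (simp only: p6 \<alpha>7 mult_1)
      also have "\<dots> = 1" using seven[OF \<beta>] by simp
      finally show ?thesis using \<open>T ^ 6 \<noteq> 1\<close> by simp
    qed
  qed
qed

end

context
  fixes \<alpha> T N :: 'a
  assumes \<alpha>: "\<alpha> \<noteq> 0" and T_def: "T = \<alpha> + \<alpha> ^ q" and N_def: "N = \<alpha> ^ (q + 1)"
begin

lemmas tn = trace_in_F[OF \<alpha> T_def N_def] norm_in_F'[OF \<alpha> T_def N_def] norm_nz[OF \<alpha> T_def N_def]

text \<open>If \<open>T = 0\<close>, a collision at distance \<open>v\<close> makes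
  \<open>\<alpha>\<close> equal to \<open>v ^ 2\<close> or \<open>- (v ^ 2)\<close>, hence an
  element of \<open>F\<close>. Otherwise it reads
  \<open>(v ^ 2 - \<alpha>) ^ 2 = - \<alpha> * r ^ 2\<close>, and \<open>- 1 = 2 ^ 2\<close> turns
  the non-square \<open>\<alpha>\<close> into a square.\<close>

lemma char_5_sufficient:
  assumes char: "CHAR('a) = 5"
    and disj: "\<alpha> ^ (q - 1) = - 1 \<or> \<alpha> ^ ((q - 1) div 2) = - 1"
  shows "inj_on (\<lambda>t. t ^ 5 + T * t ^ 3 + N * t) F"
proof (rule inj_onI, rule ccontr)
  fix x y assume xy: "x \<in> F" "y \<in> F" "x \<noteq> y"
    and eq: "x ^ 5 + T * x ^ 3 + N * x = y ^ 5 + T * y ^ 3 + N * y"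
  have five: "(5::'a) = 0" using char by (simp add: five_eq_0_iff)
  have two: "(2::'a) \<noteq> 0" using char by (simp add: two_eq_0_iff)
  have one: "(1::'a) \<noteq> - 1" using two by (metis add_eq_0_iff one_add_one)
  obtain n where n: "q = 5 ^ n" "n > 0" using q_char_power char by auto
  then have "odd q" by simp
  then have half: "q - 1 = (q - 1) div 2 * 2" using q_gt_1 by presburger
  define v where "v = x - y"
  have v: "v \<in> F" "v \<noteq> 0" using xy by (auto simp: v_def intro!: F_diff)
  have "v * (v ^ 4 - T * v\<^sup>2 + N + 3 * T * (y + 3 * v)\<^sup>2) = 0"
    using quintic_diff_char_5[OF five, of y v T N] eq by (simp add: v_def)
  then have v_eq: "v ^ 4 - T * v\<^sup>2 + N + 3 * T * (y + 3 * v)\<^sup>2 = 0" using v by simp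
  from disj show False
  proof
    assume \<alpha>1: "\<alpha> ^ (q - 1) = - 1"
    then have "T = 0" and "N = - \<alpha>\<^sup>2"
      using T_eq_0_iff[OF \<alpha> T_def N_def] N_eq[OF \<alpha> T_def N_def] by simp_all
    with v_eq have "(v\<^sup>2)\<^sup>2 = \<alpha>\<^sup>2" by (simp flip: power_mult)
    then have "\<alpha> = v\<^sup>2 \<or> \<alpha> = - (v\<^sup>2)" by (metis power2_eq_iff)
    then have "\<alpha> \<in> F" using v by (auto intro: F_uminus F_power)
    then have "\<alpha> ^ (q - 1) = 1" using \<alpha> by (rule F_power_q_minus_1)
    with \<alpha>1 one show False by simp
  next
    assume \<alpha>1: "\<alpha> ^ ((q - 1) div 2) = - 1"
    then have "\<alpha> ^ (q - 1) = 1" using half by (metis power_mult power2_minus power_one)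
    then have T: "T = 2 * \<alpha>" and N: "N = \<alpha>\<^sup>2"
      using T_eq[OF \<alpha> T_def N_def] N_eq[OF \<alpha> T_def N_def] by simp_all
    have not_square: "\<alpha> \<noteq> w\<^sup>2" if "w \<in> F" for w
    proof
      assume w: "\<alpha> = w\<^sup>2"
      then have "w \<noteq> 0" using \<alpha> by auto
      have "\<alpha> ^ ((q - 1) div 2) = w ^ (q - 1)"
        unfolding w using half by (metis power_mult mult.commute)
      then show False using F_power_q_minus_1[OF that \<open>w \<noteq> 0\<close>] \<alpha>1 one by simp
    qed
    define r where "r = y + 3 * v"
    have r: "r \<in> F" unfolding r_def using xy v by (intro F_intros)
    have "\<alpha> * r\<^sup>2 = (2 * (v\<^sup>2 - \<alpha>))\<^sup>2
        - 4 * (v ^ 4 - T * v\<^sup>2 + N + 3 * T * r\<^sup>2) + 5 * (5 * (\<alpha> * r\<^sup>2))"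
      unfolding T N by (simp add: power2_eq_square power4_eq_xxxx algebra_simps)
    also have "\<dots> = (2 * (v\<^sup>2 - \<alpha>))\<^sup>2"
      using v_eq[folded r_def] five by (simp only: mult_zero_left mult_zero_right diff_zero add_0_right)
    finally have r2: "\<alpha> * r\<^sup>2 = (2 * (v\<^sup>2 - \<alpha>))\<^sup>2" .
    show False
    proof (cases "r = 0")
      case True
      then have "\<alpha> = v\<^sup>2" using r2 two by simp
      with not_square v show False by blast
    next
      case False
      define w where "w = 2 * (v\<^sup>2 - \<alpha>) / r"
      have "\<alpha> = w\<^sup>2" using r2 False by (simp add: w_def power_divide field_simps)
      moreover have "\<alpha> \<in> F" using \<open>\<alpha> ^ (q - 1) = 1\<close> \<alpha> by (simp add: F_iff_power_q_minus_1)
      then have "w \<in> F" unfolding w_def using v r by (intro F_intros)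
      ultimately show False using not_square by blast
    qed
  qed
qed

lemma char_5_necessary:
  assumes char: "CHAR('a) = 5" and "q \<noteq> 5"
    and inj: "inj_on (\<lambda>t. t ^ 5 + T * t ^ 3 + N * t) F"
  shows "\<alpha> ^ (q - 1) = - 1 \<or> \<alpha> ^ ((q - 1) div 2) = - 1"
proof (cases "T = 0")
  case True
  then show ?thesis using T_eq_0_iff[OF \<alpha> T_def N_def] by simp
next
  case False
  have five: "(5::'a) = 0" using char by (simp add: five_eq_0_iff)
  have two: "(2::'a) \<noteq> 0" using char by (simp add: two_eq_0_iff)
  have odd: "odd q" using q_char_power char by auto
  have "T\<^sup>2 = 4 * N" by (rule char_5_discriminant[OF assms(1,2) tn False inj])
  then have "(\<alpha> - \<alpha> ^ q)\<^sup>2 = 0" using discriminant[OF \<alpha> T_def N_def] by simp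
  then have \<alpha>q: "\<alpha> ^ q = \<alpha>" by simp
  then have \<alpha>F: "\<alpha> \<in> F" by (simp add: F_def)
  have "\<alpha> ^ ((q - 1) div 2) \<noteq> 1"
  proof
    assume "\<alpha> ^ ((q - 1) div 2) = 1"
    then obtain x where x: "x \<in> F" "x\<^sup>2 = \<alpha>" "x \<noteq> 0"
      using euler_square[OF odd \<alpha>F] by blast
    have "T = 2 * x\<^sup>2" "N = x ^ 4"
      by (simp_all add: T_def N_def \<alpha>q x flip: power2_eq_square) (simp flip: x(2) power_mult)
    \<comment> \<open>The quintic is now \<open>t * (t ^ 2 + x ^ 2) ^ 2\<close>, and
      \<open>2 ^ 2 = - 1\<close> makes \<open>2 * x\<close> a second zero.\<close>
    then have "(2 * x) ^ 5 + T * (2 * x) ^ 3 + N * (2 * x) = 5 * (10 * x ^ 5)"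
      by (simp add: power_mult_distrib eval_nat_numeral)
    then have "2 * x = 0"
      using five x F_mult[OF F_numeral x(1)] inj_onD[OF inj, of "2 * x" 0] by simp
    with x two show False by simp
  qed
  then show ?thesis using euler_cases[OF odd \<alpha>F \<alpha>] by blast
qed

text \<open>Since \<open>t ^ 5 = t\<close> on \<open>F\<close>, the quintic acts as
  \<open>T * t ^ 3 + (1 + N) * t\<close>. It permutes if \<open>T = 0\<close>, or if
  \<open>N = - 1\<close>, cubing being its own inverse on \<open>F\<close>; otherwise the ratio
  \<open>c\<close> of the coefficients has four possible values, each with an explicit
  collision.\<close>

lemma permutation_q_5:
  assumes q: "q = 5"
  shows "inj_on (\<lambda>t. t ^ 5 + T * t ^ 3 + N * t) F \<longleftrightarrow>
    (\<alpha> ^ (q - 1) = - 1 \<or> \<alpha> ^ ((q - 1) div 2) = - 1) \<or> \<alpha> ^ 4 - \<alpha>\<^sup>2 + 1 = 0"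
    (is "inj_on ?g F \<longleftrightarrow> _")
proof -
  have char: "CHAR('a) = 5" using char_eq_if_q_prime q by simp
  have five: "(5::'a) = 0" using char by (simp add: five_eq_0_iff)
  have two: "(2::'a) \<noteq> 0" using char by (simp add: two_eq_0_iff)
  have one: "(1::'a) \<noteq> - 1" using two by (metis add_eq_0_iff one_add_one)
  have "(2::'a)\<^sup>2 = 5 - 1" by simp
  then have four: "(2::'a)\<^sup>2 = - 1" by (simp only: five diff_0)
  have pow5: "t ^ 5 = t" if "t \<in> F" for t
  proof -
    have "t ^ q = t" using that by (simp only: F_def mem_Collect_eq)
    then show ?thesis by (simp add: q)
  qed
  have T0: "T = 0 \<longleftrightarrow> \<alpha> ^ 4 = - 1" using T_eq_0_iff[OF \<alpha> T_def N_def] by (simp add: q)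
  have N: "N = \<alpha> ^ 6" by (simp add: N_def q)
  have N1: "N = - 1 \<longleftrightarrow> \<alpha>\<^sup>2 = - 1 \<or> \<alpha> ^ 4 - \<alpha>\<^sup>2 + 1 = 0"
  proof -
    have "N + 1 = (\<alpha>\<^sup>2 + 1) * (\<alpha> ^ 4 - \<alpha>\<^sup>2 + 1)"
      unfolding N by (simp add: algebra_simps eval_nat_numeral)
    then show ?thesis by (metis eq_neg_iff_add_eq_0 mult_eq_0_iff)
  qed
  have "inj_on ?g F" if "N = - 1"
  proof (rule inj_onI)
    have "T \<noteq> 0"
    proof
      assume "T = 0"
      then have a4: "\<alpha> ^ 4 = - 1" using T0 by simp
      have "\<alpha> ^ 6 = \<alpha> ^ 4 * \<alpha>\<^sup>2" by (simp flip: power_add)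
      then have "\<alpha>\<^sup>2 = 1" using that N a4 by simp
      then have "(\<alpha>\<^sup>2)\<^sup>2 = 1" by simp
      then show False using a4 one by (simp flip: power_mult)
    qed
    fix x y assume xy: "x \<in> F" "y \<in> F" "?g x = ?g y"
    have "t ^ 9 = t" if "t \<in> F" for t
    proof -
      have "t ^ 9 = t ^ 5 * t ^ 4" by (simp flip: power_add)
      also have "\<dots> = t * t ^ 4" by (simp only: pow5[OF that])
      also have "\<dots> = t ^ 5" by (simp add: eval_nat_numeral)
      finally show ?thesis using pow5[OF that] by simp
    qed
    then have cube: "(t ^ 3) ^ 3 = t" if "t \<in> F" for t using that by (simp flip: power_mult)
    have "T * x ^ 3 = T * y ^ 3" using xy pow5 that by simp
    then have "x ^ 3 = y ^ 3" using \<open>T \<noteq> 0\<close> by simp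
    then show "x = y" using cube xy by metis
  qed
  moreover have "N = - 1" if inj: "inj_on ?g F" and "T \<noteq> 0"
  proof (rule ccontr)
    assume N1: "N \<noteq> - 1"
    define c where "c = (1 + N) / T"
    have c0: "c \<noteq> 0" using N1 \<open>T \<noteq> 0\<close> by (simp add: c_def add_eq_0_iff)
    have cF: "c \<in> F" unfolding c_def using tn by (intro F_intros)
    have g: "?g t = T * (t ^ 3 + c * t)" if "t \<in> F" for t
      using pow5[OF that] \<open>T \<noteq> 0\<close> by (simp add: c_def field_simps)
    have inj': "s = t" if "s \<in> F" "t \<in> F" "s ^ 3 + c * s = t ^ 3 + c * t" for s t
      using inj_onD[OF inj, of s t] that g by metis
    have "c ^ 4 = 1" using F_power_q_minus_1[OF cF c0] by (simp add: q)
    then have "(c\<^sup>2)\<^sup>2 = 1" by (simp flip: power_mult)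
    then have "c\<^sup>2 = 1 \<or> c\<^sup>2 = - 1" by (rule power2_eq_1_iff[THEN iffD1])
    then have "c\<^sup>2 = 1\<^sup>2 \<or> c\<^sup>2 = 2\<^sup>2" by (simp only: four power_one)
    then have "(c = 1 \<or> c = - 1) \<or> (c = 2 \<or> c = - 2)" by (simp only: power2_eq_iff)
    then consider "c = 1" | "c = - 1" | "c = 2" | "c = - 2" by blast
    then show False
    proof cases
      case 1
      have "(2::'a) ^ 3 + c * 2 = 0 ^ 3 + c * 0 + 5 * 2" using 1 by simp
      then have "(2::'a) ^ 3 + c * 2 = 0 ^ 3 + c * 0" by (simp only: five mult_zero_left add_0_right)
      from inj'[OF _ _ this] two show False by simp
    next
      case 2
      then have "1 ^ 3 + c * 1 = 0 ^ 3 + c * 0" by simp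
      from inj'[OF _ _ this] show False by simp
    next
      case 3
      have "1 ^ 3 + c * 1 = (- 2) ^ 3 + c * (- 2) + 5 * 3" using 3 by simp
      then have "1 ^ 3 + c * 1 = (- 2) ^ 3 + c * (- 2)" by (simp only: five mult_zero_left add_0_right)
      from inj'[OF _ _ this] have "(1::'a) = - 2" by (simp add: F_uminus)
      then have "(1::'a) + 2 = 0" by (simp only: eq_neg_iff_add_eq_0)
      then show False using char three_eq_0_iff by simp
    next
      case 4
      have "2 ^ 3 + c * 2 = 1 ^ 3 + c * 1 + 5" using 4 by simp
      then have "2 ^ 3 + c * 2 = 1 ^ 3 + c * 1" by (simp only: five add_0_right)
      from inj'[OF _ _ this] have "(1::'a) + 1 = 1" by simp
      then show False by (metis add_cancel_left_right one_neq_zero)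
    qed
  qed
  moreover have "inj_on ?g F" if "T = 0"
    using char_5_sufficient[OF char] that T0 q by simp
  ultimately show ?thesis using T0 N1 by (auto simp: q)
qed

end

section \<open>The criterion for each residue of \<open>q\<close> modulo 5\<close>

lemma permutation_poly_char_5:
  fixes \<alpha> :: 'a
  assumes "\<alpha> \<noteq> 0" "q mod 5 = 0"
  shows "permutation_poly (monom 1 (2 * q + 3) + monom \<alpha> 1) \<longleftrightarrow>
    (\<alpha> ^ (q - 1) = - 1 \<or> \<alpha> ^ ((q - 1) div 2) = - 1) \<or> (q = 5 \<and> \<alpha> ^ 4 - \<alpha>\<^sup>2 + 1 = 0)"
proof -
  have char: "CHAR('a) = 5" using assms q_mod_5_eq_0_iff by simp
  show ?thesis unfolding permutation_poly_iff[OF assms(1)]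
    using char_5_sufficient[OF assms(1) refl refl char] char_5_necessary[OF assms(1) refl refl char]
      permutation_q_5[OF assms(1) refl refl]
    by blast
qed

lemma permutation_poly_q_mod_5:
  fixes \<alpha> :: 'a
  assumes \<alpha>: "\<alpha> \<noteq> 0" and q5: "q mod 5 = 2 \<or> q mod 5 = 3"
  shows "permutation_poly (monom 1 (2 * q + 3) + monom \<alpha> 1) \<longleftrightarrow>
    \<alpha> ^ (2 * q - 2) - 3 * \<alpha> ^ (q - 1) + 1 = 0 \<or>
    (q = 13 \<and> \<alpha> ^ 12 - 3 * \<alpha> ^ 6 + 1 = 0) \<or> (q = 3 \<and> (\<alpha> = 1 \<or> \<alpha>\<^sup>2 = - 1))"
proof -
  define T N where "T = \<alpha> + \<alpha> ^ q" and "N = \<alpha> ^ (q + 1)"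
  note TN = T_def N_def
  note tn = trace_in_F[OF \<alpha> TN] norm_in_F'[OF \<alpha> TN] norm_nz[OF \<alpha> TN]
  let ?inj = "inj_on (\<lambda>t. t ^ 5 + T * t ^ 3 + N * t) F"
  have "?inj \<longleftrightarrow> T\<^sup>2 = 5 * N \<or> (q = 13 \<and> \<alpha> ^ 12 - 3 * \<alpha> ^ 6 + 1 = 0) \<or>
      (q = 3 \<and> (\<alpha> = 1 \<or> \<alpha>\<^sup>2 = - 1))"
  proof
    assume inj: ?inj
    consider "q = 2" | "q = 3" | "q mod 5 = 2" "q \<noteq> 2" | "q mod 5 = 3" "q \<noteq> 3"
      using q5 by blast
    then show "T\<^sup>2 = 5 * N \<or> (q = 13 \<and> \<alpha> ^ 12 - 3 * \<alpha> ^ 6 + 1 = 0) \<or>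
        (q = 3 \<and> (\<alpha> = 1 \<or> \<alpha>\<^sup>2 = - 1))"
    proof cases
      case 1
      then show ?thesis using permutation_q_2[OF \<alpha> TN] inj by blast
    next
      case 2
      then show ?thesis using permutation_q_3[OF \<alpha> TN] inj by blast
    next
      case 3
      then show ?thesis using dickson_if_q_mod_5_eq_2[OF tn inj] by blast
    next
      case 4
      then show ?thesis
        using dickson_if_q_mod_5_eq_3[OF tn inj] seventeen_neq_0[OF \<alpha> TN] permutation_q_13[OF \<alpha> TN] inj
        by blast
    qed
  next
    assume "T\<^sup>2 = 5 * N \<or> (q = 13 \<and> \<alpha> ^ 12 - 3 * \<alpha> ^ 6 + 1 = 0) \<or>
        (q = 3 \<and> (\<alpha> = 1 \<or> \<alpha>\<^sup>2 = - 1))"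
    then show ?inj
      using inj_on_dickson_quintic[OF q5 tn] permutation_q_13[OF \<alpha> TN] permutation_q_3[OF \<alpha> TN]
      by blast
  qed
  then show ?thesis
    unfolding permutation_poly_iff[OF \<alpha>] golden_iff[OF \<alpha> TN] TN .
qed

lemma not_permutation_poly:
  fixes \<alpha> :: 'a
  assumes \<alpha>: "\<alpha> \<noteq> 0" and q5: "q mod 5 = 1 \<or> q mod 5 = 4"
  shows "\<not> permutation_poly (monom 1 (2 * q + 3) + monom \<alpha> 1)"
  unfolding permutation_poly_iff[OF \<alpha>]
  using q5 q_mod_5_neq_1[OF trace_in_F norm_in_F' norm_nz] \<alpha> not_inj_if_q_mod_5_eq_4 by blast

section \<open>Counting\<close>

text \<open>In odd characteristic the roots come from a square root of 5, which exists in the big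
  field because 5 lies in \<open>F\<close>. In characteristic 2 they are the primitive cube roots of
  unity, as 3 divides \<open>q ^ 2 - 1\<close>.\<close>

lemma golden_root_exists:
  assumes q5: "q mod 5 = 2 \<or> q mod 5 = 3"
  shows "\<exists>\<beta>::'a. \<beta>\<^sup>2 - 3 * \<beta> + 1 = 0"
proof (cases "CHAR('a) = 2")
  case True
  then have two: "(2::'a) = 0" by (simp add: two_eq_0_iff)
  have "\<not> 3 dvd q" using q_char_power True prime_dvd_power[of 3 "2::nat"] by auto
  then have "3 dvd (q - 1) \<or> 3 dvd (q + 1)" by presburger
  then have "3 dvd card (UNIV :: 'a set) - 1"
    unfolding card_field_minus_1[symmetric] by (metis dvd_mult dvd_mult2)
  then obtain e where "3 * e = card (UNIV :: 'a set) - 1" by (metis dvdE)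
  then have "card {x::'a. x ^ 3 = 1} = 3" by (rule card_power_eq) simp
  then have "\<not> {x::'a. x ^ 3 = 1} \<subseteq> {1}"
    using card_mono[of "{1::'a}" "{x. x ^ 3 = 1}"] by auto
  then obtain x :: 'a where x: "x ^ 3 = 1" "x \<noteq> 1" by blast
  have "(x - 1) * (x\<^sup>2 - 3 * x + 1) = x ^ 3 - 1 - 2 * (2 * x\<^sup>2 - 2 * x)"
    by (simp add: eval_nat_numeral algebra_simps)
  also have "\<dots> = 0" using x two by simp
  finally show ?thesis using x by auto
next
  case False
  then have two: "(2::'a) \<noteq> 0" by (simp add: two_eq_0_iff)
  have five: "(5::'a) \<noteq> 0" using q5 by (intro five_neq_0) auto
  obtain n where n: "q = CHAR('a) ^ n" "n > 0" using q_char_power by auto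
  have "odd (CHAR('a))"
    using CHAR_prime[where ?'a = 'a] False primes_dvd_imp_eq[of 2 "CHAR('a)"] by auto
  then have "odd q" using n by simp
  then have "q + 1 = 2 * ((q + 1) div 2)" by simp
  then have "2 * ((q - 1) * ((q + 1) div 2)) = card (UNIV :: 'a set) - 1"
    using card_field_minus_1 by (metis mult.left_commute)
  moreover have "(5::'a) ^ ((q - 1) * ((q + 1) div 2)) = 1"
    using F_power_q_minus_1[OF F_numeral five] by (simp only: power_mult power_one)
  ultimately have "card {x::'a. x\<^sup>2 = 5} = 2" by (rule card_power_eq)
  then have "{x::'a. x\<^sup>2 = 5} \<noteq> {}" by fastforce
  then obtain r :: 'a where r: "r\<^sup>2 = 5" by blast
  define \<beta> where "\<beta> = (3 + r) / 2"
  have \<beta>: "2 * \<beta> = 3 + r" using two by (simp add: \<beta>_def)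
  have "2 * (2 * (\<beta>\<^sup>2 - 3 * \<beta> + 1)) = (2 * \<beta>)\<^sup>2 - 6 * (2 * \<beta>) + 4"
    by (simp add: power2_eq_square algebra_simps)
  also have "\<dots> = r\<^sup>2 - 5"
    unfolding \<beta> by (simp add: power2_eq_square algebra_simps)
  finally have "2 * (2 * (\<beta>\<^sup>2 - 3 * \<beta> + 1)) = 0" using r by simp
  then have "\<beta>\<^sup>2 - 3 * \<beta> + 1 = 0"
    using two by (simp only: mult_eq_0_iff simp_thms)
  then show ?thesis by blast
qed

text \<open>A root \<open>\<beta>\<close> lies outside \<open>F\<close>, so its conjugate
  \<open>\<beta> ^ q\<close> is the other root, and the norm of \<open>\<beta>\<close> is the
  product 1 of the roots.\<close>

lemma golden_roots:
  assumes q5: "q mod 5 = 2 \<or> q mod 5 = 3"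
  obtains \<beta> \<gamma> :: 'a where "\<beta> \<noteq> \<gamma>" "\<beta> ^ (q + 1) = 1" "\<gamma> ^ (q + 1) = 1"
    "\<And>y. y\<^sup>2 - 3 * y + 1 = 0 \<longleftrightarrow> y = \<beta> \<or> y = \<gamma>"
proof -
  obtain \<beta> :: 'a where \<beta>: "\<beta>\<^sup>2 - 3 * \<beta> + 1 = 0" using golden_root_exists[OF q5] by blast
  define \<gamma> where "\<gamma> = \<beta> ^ q"
  have "(3::'a) ^ q = 3" using F_numeral by (simp add: F_def del: F_numeral)
  moreover have "(\<beta>\<^sup>2) ^ q = \<gamma>\<^sup>2" by (simp add: \<gamma>_def mult.commute flip: power_mult)
  ultimately have "(\<beta>\<^sup>2 - 3 * \<beta> + 1) ^ q = \<gamma>\<^sup>2 - 3 * \<gamma> + 1"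
    by (simp add: frobenius_add frobenius_diff power_mult_distrib \<gamma>_def)
  then have \<gamma>: "\<gamma>\<^sup>2 - 3 * \<gamma> + 1 = 0" using \<beta> q_gt_1 by (simp add: power_0_left)
  have ne: "\<beta> \<noteq> \<gamma>" using no_root_in_F[OF q5] \<beta> by (auto simp: F_def \<gamma>_def)
  have "(\<beta> - \<gamma>) * (\<beta> + \<gamma> - 3) = (\<beta>\<^sup>2 - 3 * \<beta> + 1) - (\<gamma>\<^sup>2 - 3 * \<gamma> + 1)"
    by (simp add: power2_eq_square algebra_simps)
  then have sum: "\<beta> + \<gamma> = 3" using \<beta> \<gamma> ne by simp
  have "\<beta> * \<gamma> = 1 + \<beta> * (\<beta> + \<gamma> - 3) - (\<beta>\<^sup>2 - 3 * \<beta> + 1)"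
    by (simp add: power2_eq_square algebra_simps)
  then have prod: "\<beta> * \<gamma> = 1" using sum \<beta> by simp
  then have 1: "\<beta> ^ (q + 1) = 1" by (simp add: \<gamma>_def)
  then have "(\<beta> ^ (q + 1)) ^ q = 1" by simp
  then have 2: "\<gamma> ^ (q + 1) = 1" by (simp only: \<gamma>_def mult.commute flip: power_mult)
  have "y\<^sup>2 - 3 * y + 1 = (y - \<beta>) * (y - \<gamma>) + (\<beta> + \<gamma> - 3) * y - (\<beta> * \<gamma> - 1)" for y
    by (simp add: power2_eq_square algebra_simps)
  then have "y\<^sup>2 - 3 * y + 1 = (y - \<beta>) * (y - \<gamma>)" for y using sum prod by simp
  with ne 1 2 that show ?thesis by simp
qed

text \<open>The divisibility makes both roots \<open>d\<close>-th powers. It serves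
  \<open>d = q - 1\<close> and, for \<open>q = 13\<close>, also \<open>d = 6\<close> with
  \<open>e = 28\<close>.\<close>

lemma card_golden:
  assumes q5: "q mod 5 = 2 \<or> q mod 5 = 3"
    and de: "d * e = card (UNIV :: 'a set) - 1" and "(q + 1) dvd e"
  shows "card {\<alpha>::'a. (\<alpha> ^ d)\<^sup>2 - 3 * \<alpha> ^ d + 1 = 0} = 2 * d"
proof -
  obtain \<beta> \<gamma> :: 'a where \<beta>\<gamma>: "\<beta> \<noteq> \<gamma>" "\<beta> ^ (q + 1) = 1" "\<gamma> ^ (q + 1) = 1"
    and roots: "\<And>y. y\<^sup>2 - 3 * y + 1 = 0 \<longleftrightarrow> y = \<beta> \<or> y = \<gamma>"
    using golden_roots[OF q5] by blast
  obtain k where "e = (q + 1) * k" using assms(3) by (elim dvdE)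
  then have "\<beta> ^ e = 1" "\<gamma> ^ e = 1" using \<beta>\<gamma> by (simp_all only: power_mult power_one)
  then have "card {x. x ^ d = \<beta>} = d" "card {x. x ^ d = \<gamma>} = d"
    using card_power_eq[OF de] by blast+
  moreover have "{\<alpha>. (\<alpha> ^ d)\<^sup>2 - 3 * \<alpha> ^ d + 1 = 0} = {x. x ^ d = \<beta>} \<union> {x. x ^ d = \<gamma>}"
    using roots by blast
  moreover have "{x. x ^ d = \<beta>} \<inter> {x. x ^ d = \<gamma>} = {}" using \<beta>\<gamma>(1) by blast
  ultimately show ?thesis by (simp add: card_Un_disjoint)
qed

lemma card_char_5:
  assumes "q mod 5 = 0"
  shows "card {\<alpha>::'a. \<alpha> ^ (q - 1) = - 1 \<or> \<alpha> ^ ((q - 1) div 2) = - 1} = 3 * (q - 1) div 2"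
proof -
  have char: "CHAR('a) = 5" using assms q_mod_5_eq_0_iff by simp
  then have "(2::'a) \<noteq> 0" by (simp add: two_eq_0_iff)
  then have one: "(1::'a) \<noteq> - 1" by (metis add_eq_0_iff one_add_one)
  have odd: "odd q" using q_char_power char by auto
  define M where "M = (q - 1) div 2"
  have M: "q - 1 = M * 2" using odd q_gt_1 unfolding M_def by presburger
  have "card {\<alpha>::'a. \<alpha> ^ (q - 1) = - 1} = q - 1"
    by (rule card_power_eq[OF card_field_minus_1]) (use odd in simp)
  moreover have "M * (2 * (q + 1)) = card (UNIV :: 'a set) - 1"
    using card_field_minus_1 M by (metis mult.assoc)
  then have "card {\<alpha>::'a. \<alpha> ^ M = - 1} = M"
    by (rule card_power_eq) (simp only: power_mult power2_minus power_one)
  moreover have "{\<alpha>::'a. \<alpha> ^ (q - 1) = - 1} \<inter> {\<alpha>. \<alpha> ^ M = - 1} = {}"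
    unfolding M power_mult using one by auto
  moreover have "{\<alpha>::'a. \<alpha> ^ (q - 1) = - 1 \<or> \<alpha> ^ M = - 1} =
      {\<alpha>. \<alpha> ^ (q - 1) = - 1} \<union> {\<alpha>. \<alpha> ^ M = - 1}" by blast
  moreover have "3 * (q - 1) div 2 = (q - 1) + M" unfolding M by simp
  ultimately show ?thesis unfolding M_def[symmetric] by (simp add: card_Un_disjoint)
qed

text \<open>\<open>\<alpha> ^ 2\<close> must be one of the roots \<open>y\<close> and
  \<open>1 - y\<close> of \<open>z ^ 2 - z + 1\<close>, obtained from a cube root of -1 other than
  -1. Both have 12th power 1, hence two square roots among the 24 units.\<close>

lemma card_q_5:
  assumes q: "q = 5"
  shows "card {\<alpha>::'a. \<alpha> ^ 4 - \<alpha>\<^sup>2 + 1 = 0} = 4"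
proof -
  have char: "CHAR('a) = 5" using char_eq_if_q_prime q by simp
  have "3 * 8 = card (UNIV :: 'a set) - 1" using card_field_minus_1 q by simp
  then have "card {x::'a. x ^ 3 = - 1} = 3" by (rule card_power_eq) simp
  then have "\<not> {x::'a. x ^ 3 = - 1} \<subseteq> {- 1}"
    using card_mono[of "{- 1::'a}" "{x. x ^ 3 = - 1}"] by auto
  then obtain y :: 'a where y: "y ^ 3 = - 1" "y \<noteq> - 1" by blast
  have "(y + 1) * (y\<^sup>2 - y + 1) = y ^ 3 + 1"
    by (simp add: eval_nat_numeral algebra_simps)
  also have "\<dots> = 0" using y by simp
  finally have y2: "y\<^sup>2 - y + 1 = 0" using y by (simp add: add_eq_0_iff2)
  have roots: "z\<^sup>2 - z + 1 = 0 \<longleftrightarrow> z = y \<or> z = 1 - y" for z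
  proof -
    have "z\<^sup>2 - z + 1 = (z - y) * (z - (1 - y)) + (y\<^sup>2 - y + 1)"
      by (simp add: power2_eq_square algebra_simps)
    then show ?thesis using y2 by simp
  qed
  have ne: "y \<noteq> 1 - y"
  proof
    assume e: "y = 1 - y"
    have "3 + (2 * y - 1) * (2 * y - 1) = 4 * (y\<^sup>2 - y + 1)"
      by (simp add: power2_eq_square algebra_simps)
    moreover have "2 * y - 1 = y - (1 - y)" by simp
    ultimately have "(3::'a) = 0" using e y2 by simp
    then show False using char three_eq_0_iff by simp
  qed
  have y12: "z ^ 12 = 1" if "z\<^sup>2 - z + 1 = 0" for z :: 'a
  proof -
    have "z ^ 3 = (z + 1) * (z\<^sup>2 - z + 1) - 1"
      by (simp add: eval_nat_numeral algebra_simps)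
    then have "z ^ 3 = - 1" using that by simp
    then have "(z ^ 3) ^ 4 = 1" by simp
    then show ?thesis by (simp flip: power_mult)
  qed
  have "2 * 12 = card (UNIV :: 'a set) - 1" using card_field_minus_1 q by simp
  note sq = card_power_eq[OF this y12]
  have "\<alpha> ^ 4 = (\<alpha>\<^sup>2)\<^sup>2" for \<alpha> :: 'a by (simp flip: power_mult)
  then have "\<alpha> ^ 4 - \<alpha>\<^sup>2 + 1 = 0 \<longleftrightarrow> \<alpha>\<^sup>2 = y \<or> \<alpha>\<^sup>2 = 1 - y" for \<alpha> :: 'a
    by (simp only: roots)
  then have "{\<alpha>::'a. \<alpha> ^ 4 - \<alpha>\<^sup>2 + 1 = 0} = {\<alpha>. \<alpha>\<^sup>2 = y} \<union> {\<alpha>. \<alpha>\<^sup>2 = 1 - y}"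
    by blast
  moreover have "{\<alpha>. \<alpha>\<^sup>2 = y} \<inter> {\<alpha>. \<alpha>\<^sup>2 = 1 - y} = {}" using ne by auto
  moreover have "card {x. x\<^sup>2 = y} = 2" "card {x. x\<^sup>2 = 1 - y} = 2"
    using sq roots by blast+
  ultimately show ?thesis by (simp add: card_Un_disjoint)
qed

lemma card_q_3:
  assumes q: "q = 3"
  shows "card {\<alpha>::'a. \<alpha> = 1 \<or> \<alpha>\<^sup>2 = - 1} = 3"
proof -
  have char: "CHAR('a) = 3" using char_eq_if_q_prime q by simp
  then have "(2::'a) \<noteq> 0" by (simp add: two_eq_0_iff)
  then have one: "(1::'a) \<noteq> - 1" by (metis add_eq_0_iff one_add_one)
  have "2 * 4 = card (UNIV :: 'a set) - 1" using card_field_minus_1 q by simp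
  then have "card {\<alpha>::'a. \<alpha>\<^sup>2 = - 1} = 2" by (rule card_power_eq) simp
  moreover have "{\<alpha>::'a. \<alpha> = 1 \<or> \<alpha>\<^sup>2 = - 1} = insert 1 {\<alpha>. \<alpha>\<^sup>2 = - 1}" by auto
  ultimately show ?thesis using one by simp
qed

end

theorem corollary2p5:
  fixes Q :: nat
  assumes "primepow Q"
    and "card (UNIV :: 'a::finite_field set) = Q ^ 2"
  shows "(\<forall>\<alpha>::'a. \<alpha> \<noteq> 0 \<longrightarrow>
           (permutation_poly (monom 1 (2 * Q + 3) + monom \<alpha> 1) \<longleftrightarrow>
              (([int Q = 2] (mod 5) \<or> [int Q = - 2] (mod 5)) \<and>
                 \<alpha> ^ (2 * Q - 2) - 3 * \<alpha> ^ (Q - 1) + 1 = 0) \<or>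
              ((\<exists>n>0. Q = 5 ^ n) \<and>
                 (\<alpha> ^ (Q - 1) = - 1 \<or> \<alpha> ^ ((Q - 1) div 2) = - 1)) \<or>
              (Q = 13 \<and> \<alpha> ^ 12 - 3 * \<alpha> ^ 6 + 1 = 0) \<or>
              (Q = 5 \<and> \<alpha> ^ 4 - \<alpha> ^ 2 + 1 = 0) \<or>
              (Q = 3 \<and> (\<alpha> = 1 \<or> \<alpha> ^ 2 = - 1))))
       \<and> ([int Q = 2] (mod 5) \<or> [int Q = - 2] (mod 5) \<longrightarrow>
            card {\<alpha>::'a. \<alpha> ^ (2 * Q - 2) - 3 * \<alpha> ^ (Q - 1) + 1 = 0} = 2 * Q - 2)
       \<and> ((\<exists>n>0. Q = 5 ^ n) \<longrightarrow>
            card {\<alpha>::'a. \<alpha> ^ (Q - 1) = - 1 \<or> \<alpha> ^ ((Q - 1) div 2) = - 1}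
              = 3 * (Q - 1) div 2)
       \<and> (Q = 13 \<longrightarrow> card {\<alpha>::'a. \<alpha> ^ 12 - 3 * \<alpha> ^ 6 + 1 = 0} = 12)
       \<and> (Q = 5 \<longrightarrow> card {\<alpha>::'a. \<alpha> ^ 4 - \<alpha> ^ 2 + 1 = 0} = 4)
       \<and> (Q = 3 \<longrightarrow> card {\<alpha>::'a. \<alpha> = 1 \<or> \<alpha> ^ 2 = - 1} = 3)"
proof -
  interpret quadratic_extension Q "TYPE('a)"
    using assms by unfold_locales
  have q5: "[int Q = 2] (mod 5) \<or> [int Q = - 2] (mod 5) \<longleftrightarrow> Q mod 5 = 2 \<or> Q mod 5 = 3"
    using zmod_int[of Q 5] by (auto simp: cong_def)
  have pow5: "(\<exists>n>0. Q = 5 ^ n) \<longleftrightarrow> Q mod 5 = 0"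
    using q_mod_5_eq_0_iff q_char_power by auto
  have iff: "permutation_poly (monom 1 (2 * Q + 3) + monom \<alpha> 1) \<longleftrightarrow>
      (Q mod 5 = 2 \<or> Q mod 5 = 3) \<and> \<alpha> ^ (2 * Q - 2) - 3 * \<alpha> ^ (Q - 1) + 1 = 0 \<or>
      Q mod 5 = 0 \<and> (\<alpha> ^ (Q - 1) = - 1 \<or> \<alpha> ^ ((Q - 1) div 2) = - 1) \<or>
      (Q = 13 \<and> \<alpha> ^ 12 - 3 * \<alpha> ^ 6 + 1 = 0) \<or>
      (Q = 5 \<and> \<alpha> ^ 4 - \<alpha> ^ 2 + 1 = 0) \<or> (Q = 3 \<and> (\<alpha> = 1 \<or> \<alpha> ^ 2 = - 1))"
    if \<alpha>: "\<alpha> \<noteq> 0" for \<alpha> :: 'a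
  proof -
    have "Q mod 5 < 5" by simp
    then consider "Q mod 5 = 0" | "Q mod 5 = 2 \<or> Q mod 5 = 3" | "Q mod 5 = 1 \<or> Q mod 5 = 4"
      by linarith
    then show ?thesis
    proof cases
      case 1
      then have "Q \<noteq> 13" "Q \<noteq> 3" by auto
      with 1 show ?thesis using permutation_poly_char_5[OF \<alpha> 1] by simp
    next
      case 2
      then have "Q \<noteq> 5" "Q mod 5 \<noteq> 0" by auto
      with 2 show ?thesis using permutation_poly_q_mod_5[OF \<alpha> 2] by blast
    next
      case 3
      then have "Q \<noteq> 13" "Q \<noteq> 3" "Q \<noteq> 5" "Q mod 5 \<noteq> 0" "Q mod 5 \<noteq> 2" "Q mod 5 \<noteq> 3" by auto
      then show ?thesis using not_permutation_poly[OF \<alpha> 3] by blast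
    qed
  qed
  have card1: "card {\<alpha>::'a. \<alpha> ^ (2 * Q - 2) - 3 * \<alpha> ^ (Q - 1) + 1 = 0} = 2 * Q - 2"
    if "Q mod 5 = 2 \<or> Q mod 5 = 3"
  proof -
    have "2 * Q - 2 = (Q - 1) * 2" by simp
    then have "\<alpha> ^ (2 * Q - 2) = (\<alpha> ^ (Q - 1))\<^sup>2" for \<alpha> :: 'a by (simp only: power_mult)
    then show ?thesis
      using card_golden[OF that card_field_minus_1] by (simp add: right_diff_distrib')
  qed
  have card3: "card {\<alpha>::'a. \<alpha> ^ 12 - 3 * \<alpha> ^ 6 + 1 = 0} = 12" if "Q = 13"
  proof -
    have "(\<alpha> ^ 6)\<^sup>2 = \<alpha> ^ 12" for \<alpha> :: 'a by (simp flip: power_mult)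
    moreover have "6 * 28 = card (UNIV :: 'a set) - 1" using card_field_minus_1 that by simp
    ultimately show ?thesis using card_golden[of 6 28] that by simp
  qed
  show ?thesis
    unfolding q5 pow5
    by (intro conjI allI impI) (erule iff card1 card_char_5 card3 card_q_5 card_q_3)+
qed

end
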